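(* Let $K=(X,\delta,m)$ be a cell complex and $k\in\mathbb{N}_0$. Let $\omega:X\to(0,\infty)$ be non-degenerate. Then $$\max_{K'\le_k K}\ \min_{x\in X_k}F'_\omega(x)=\min_J\operatorname{Tr}(\delta\delta^*J),$$ where the minimum on the right is taken over all linear $J:C(X_k)\to C(X_k)$ satisfying (a) $Jf(x)\ge0$ whenever $2\langle x,\omega f\rangle\ge\|f\|_{\omega,1}$ (for $x\in X_k$, $f\in C(X_k)$), (b) $\delta J\delta^*z(z)\le0$ for all $z\in X_{k+1}$, (c) $\operatorname{Tr}(J)=1$.
   Context: For a finite set $X$, $C(X)=\mathbb{R}^X$, and $x\in X$ is identified with its indicator function $1_x\in C(X)$. A cell complex $K=(X,\delta,m)$ consists of a finite set of cells $X=\dot\bigcup_{k\ge 0}X_k$, a linear operator $\delta:C(X)\to C(X)$ (coboundary) and a weight $m:X\to(0,\infty)$. Write $\dim(z)=k$ iff $z\in X_k$, and $x\lessdot z$ (equivalently $z\gtrdot x$) iff $\delta x(z)\ne 0$. It is required that for all $v,z,z'\in X$: $\delta v(z)\in\{-1,0,1\}$; $\delta v(z)=0$ if $\dim(z)-\dim(v)\ne 1$; if $\dim(z)\ge 1$ there exists $x\lessdot z$; and (i) for every $x\in X_1$ there is exactly one $w\in X_0$ with $\delta w(x)=1$ and exactly one $w\in X_0$ with $\delta w(x)=-1$; (ii) if $\dim(z)-\dim(v)=2$ and $\{x:v\lessdot x\lessdot z\}\ne\emptyset$, then $|\{x:v\lessdot x\lessdot z\}|=2$ and $\{\delta v(x)\,\delta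 x(z):x\in X\}\supseteq\{-1,1\}$ (hence $\delta\delta=0$); (iii) for all $x,y\lessdot z$ there is a sequence $(x=x_0,\dots,x_n=y)$ of cells with $\delta x_i(x_{i-1})+\delta x_{i-1}(x_i)\ne0$ for all $i=1,\dots,n$; (iv) if $\{x:x\lessdot z\}=\{x:x\lessdot z'\}$ and $\dim(z)\ge 1$, then $z=z'$. $C(X)$ carries the scalar product $\langle f,g\rangle=\sum_{x\in X}f(x)g(x)m(x)$, $\delta^*$ is the adjoint of $\delta$, and $H=\delta\delta^*+\delta^*\delta$ is the Hodge Laplacian. For cell complexes $K=(X,\delta,m)$, $K'=(X',\delta',m')$ write $K'\le_k K$ if $X'_j=X_j$ for $j\le k$, $X'_j\subseteq X_j$ for $j>k$, $m(x)=m'(x)$ whenever $\dim(x)\le k$, and $\delta'v(x)=\delta v(x)$ for all $v,x\in X'$. For $v,w\in X_0$, $v\sim w$ iff they are the two vertices of some edge $x\in X_1$, in which case $\omega(v,w)=\omega(x)$. $d_\omega(v,w)=\inf\{\sum_{k=1}^n\omega(v_k,v_{k-1}):v=v_0\sim\dots\sim v_n=w\}$. $\omega$ is non-degenerate if every edge $x=(v,w)\in X_1$ is the unique shortest path (with respect to $d_\omega$) between its vertices. $F_\omega(x)=Hx(x)-\sum_{y\ne x}\frac{\omega(y)}{\omega(x)}|Hy(x)|$, and $F'_\omega$ is the same quantity for $K'$ (with its Hodge Laplacian). $\delta,\delta^*$ on the right-hand side are those of $K$. $\|f\|_{\omega,1}=\sum_{x}m(x)\omega(x)|f(x)|$. For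 linear $J:C(X_k)\to C(X_k)$, $\operatorname{Tr}J=\sum_{x\in X_k}Jx(x)$. *)

theory Defs
  imports Complex_Main "HOL-Library.Indicator_Function" "HOL-Library.Extended_Real"
begin

subsection \<open>Functions on a finite set and linear operators\<close>

text \<open>
  The space C(X) of real functions on X is rendered as the functions on the ambient type vanishing
  off X; so for A contained in X, C(A) is literally a subspace of C(X).  Operators on C(X) are only
  constrained on arguments from C(X).
\<close>

definition fun_space :: "'a set \<Rightarrow> ('a \<Rightarrow> real) set" where
  "fun_space X = {f. \<forall>x. x \<notin> X \<longrightarrow> f x = 0}"

abbreviation ind :: "'a \<Rightarrow> 'a \<Rightarrow> real" where
  "ind x \<equiv> indicat_real {x}"

definition linear_operator_on :: "'a set \<Rightarrow> (('a \<Rightarrow> real) \<Rightarrow> ('a \<Rightarrow> real)) \<Rightarrow> bool" where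
  "linear_operator_on X T \<longleftrightarrow>
     (\<forall>f\<in>fun_space X. T f \<in> fun_space X) \<and>
     (\<forall>f\<in>fun_space X. \<forall>g\<in>fun_space X. T (\<lambda>x. f x + g x) = (\<lambda>x. T f x + T g x)) \<and>
     (\<forall>c. \<forall>f\<in>fun_space X. T (\<lambda>x. c * f x) = (\<lambda>x. c * T f x))"

definition trace_on :: "'a set \<Rightarrow> (('a \<Rightarrow> real) \<Rightarrow> ('a \<Rightarrow> real)) \<Rightarrow> real" where
  "trace_on X T = (\<Sum>x\<in>X. T (ind x) x)"


subsection \<open>Cell complexes\<close>

record 'a complex_data =
  cells :: "nat \<Rightarrow> 'a set"
  coboundary :: "('a \<Rightarrow> real) \<Rightarrow> ('a \<Rightarrow> real)"
  weight :: "'a \<Rightarrow> real"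

definition all_cells :: "'a complex_data \<Rightarrow> 'a set" where
  "all_cells K = (\<Union>k. cells K k)"

definition cell_dim :: "'a complex_data \<Rightarrow> 'a \<Rightarrow> nat" where
  "cell_dim K z = (THE k. z \<in> cells K k)"

definition facet :: "'a complex_data \<Rightarrow> 'a \<Rightarrow> 'a \<Rightarrow> bool" where
  "facet K x z \<longleftrightarrow> x \<in> all_cells K \<and> z \<in> all_cells K \<and> coboundary K (ind x) z \<noteq> 0"

definition between :: "'a complex_data \<Rightarrow> 'a \<Rightarrow> 'a \<Rightarrow> 'a set" where
  "between K v z = {x. facet K v x \<and> facet K x z}"

text \<open>
  In the connectedness axiom (the last but one below), the connecting sequence may run through
  arbitrary cells of the complex.
\<close>

definition cell_complex :: "'a complex_data \<Rightarrow> bool" where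
  "cell_complex K \<longleftrightarrow>
     finite (all_cells K) \<and>
     (\<forall>j k. j \<noteq> k \<longrightarrow> cells K j \<inter> cells K k = {}) \<and>
     linear_operator_on (all_cells K) (coboundary K) \<and>
     (\<forall>x\<in>all_cells K. weight K x > 0) \<and>
     (\<forall>v\<in>all_cells K. \<forall>z\<in>all_cells K. coboundary K (ind v) z \<in> {-1, 0, 1}) \<and>
     (\<forall>v\<in>all_cells K. \<forall>z\<in>all_cells K.
        int (cell_dim K z) - int (cell_dim K v) \<noteq> 1 \<longrightarrow> coboundary K (ind v) z = 0) \<and>
     (\<forall>z\<in>all_cells K. cell_dim K z \<ge> 1 \<longrightarrow> (\<exists>x. facet K x z)) \<and>
     (\<forall>x\<in>cells K 1. (\<exists>!w. w \<in> cells K 0 \<and> coboundary K (ind w) x = 1) \<and>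
                    (\<exists>!w. w \<in> cells K 0 \<and> coboundary K (ind w) x = -1)) \<and>
     (\<forall>v\<in>all_cells K. \<forall>z\<in>all_cells K.
        int (cell_dim K z) - int (cell_dim K v) = 2 \<and> between K v z \<noteq> {} \<longrightarrow>
          card (between K v z) = 2 \<and>
          {-1, 1} \<subseteq> (\<lambda>x. coboundary K (ind v) x * coboundary K (ind x) z) ` all_cells K) \<and>
     (\<forall>z\<in>all_cells K. \<forall>x y. facet K x z \<and> facet K y z \<longrightarrow>
        (\<exists>p. p \<noteq> [] \<and> hd p = x \<and> last p = y \<and> set p \<subseteq> all_cells K \<and>
             successively (\<lambda>a b. coboundary K (ind b) a + coboundary K (ind a) b \<noteq> 0) p)) \<and>
     (\<forall>z\<in>all_cells K. \<forall>z'\<in>all_cells K.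
        {x. facet K x z} = {x. facet K x z'} \<and> cell_dim K z \<ge> 1 \<longrightarrow> z = z')"

definition inner_product :: "'a complex_data \<Rightarrow> ('a \<Rightarrow> real) \<Rightarrow> ('a \<Rightarrow> real) \<Rightarrow> real" where
  "inner_product K f g = (\<Sum>x\<in>all_cells K. f x * g x * weight K x)"

text \<open>
  On C(X) the adjoint is uniquely determined when K is a cell complex; see the lemmas
  \<open>boundary_adjoint\<close> and \<open>adjoint_unique\<close> below.
\<close>

definition is_adjoint ::
  "'a complex_data \<Rightarrow> (('a \<Rightarrow> real) \<Rightarrow> ('a \<Rightarrow> real)) \<Rightarrow> (('a \<Rightarrow> real) \<Rightarrow> ('a \<Rightarrow> real)) \<Rightarrow> bool" where
  "is_adjoint K T S \<longleftrightarrow> linear_operator_on (all_cells K) S \<and>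
     (\<forall>f\<in>fun_space (all_cells K). \<forall>g\<in>fun_space (all_cells K).
        inner_product K (T f) g = inner_product K f (S g))"

definition boundary :: "'a complex_data \<Rightarrow> ('a \<Rightarrow> real) \<Rightarrow> ('a \<Rightarrow> real)" where
  "boundary K = (SOME S. is_adjoint K (coboundary K) S)"

definition hodge :: "'a complex_data \<Rightarrow> ('a \<Rightarrow> real) \<Rightarrow> ('a \<Rightarrow> real)" where
  "hodge K f = (\<lambda>x. coboundary K (boundary K f) x + boundary K (coboundary K f) x)"

definition subcomplex_from :: "nat \<Rightarrow> 'a complex_data \<Rightarrow> 'a complex_data \<Rightarrow> bool" where
  "subcomplex_from k K' K \<longleftrightarrow>
     cell_complex K' \<and> cell_complex K \<and>
     (\<forall>j\<le>k. cells K' j = cells K j) \<and>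
     (\<forall>j>k. cells K' j \<subseteq> cells K j) \<and>
     (\<forall>j\<le>k. \<forall>x\<in>cells K j. weight K x = weight K' x) \<and>
     (\<forall>v\<in>all_cells K'. \<forall>x\<in>all_cells K'.
        coboundary K' (ind v) x = coboundary K (ind v) x)"


subsection \<open>Path distance and non-degenerate length functions\<close>

definition joins :: "'a complex_data \<Rightarrow> 'a \<Rightarrow> 'a \<Rightarrow> 'a \<Rightarrow> bool" where
  "joins K x v w \<longleftrightarrow> x \<in> cells K 1 \<and> v \<noteq> w \<and> {u. facet K u x} = {v, w}"

definition adjacent :: "'a complex_data \<Rightarrow> 'a \<Rightarrow> 'a \<Rightarrow> bool" where
  "adjacent K v w \<longleftrightarrow> (\<exists>x. joins K x v w)"

text \<open>The edge joining two adjacent vertices is unique, by the last axiom of a cell complex.\<close>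

definition edge_length :: "'a complex_data \<Rightarrow> ('a \<Rightarrow> real) \<Rightarrow> 'a \<Rightarrow> 'a \<Rightarrow> real" where
  "edge_length K \<omega> v w = \<omega> (THE x. joins K x v w)"

definition vertex_path :: "'a complex_data \<Rightarrow> 'a \<Rightarrow> 'a list \<Rightarrow> 'a \<Rightarrow> bool" where
  "vertex_path K v p w \<longleftrightarrow>
     p \<noteq> [] \<and> hd p = v \<and> last p = w \<and> set p \<subseteq> cells K 0 \<and> successively (adjacent K) p"

definition path_length :: "'a complex_data \<Rightarrow> ('a \<Rightarrow> real) \<Rightarrow> 'a list \<Rightarrow> real" where
  "path_length K \<omega> p = (\<Sum>i<length p - 1. edge_length K \<omega> (p ! Suc i) (p ! i))"

text \<open>Extended reals, so that the distance between different components is infinite.\<close>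

definition path_dist :: "'a complex_data \<Rightarrow> ('a \<Rightarrow> real) \<Rightarrow> 'a \<Rightarrow> 'a \<Rightarrow> ereal" where
  "path_dist K \<omega> v w = (INF p\<in>{p. vertex_path K v p w}. ereal (path_length K \<omega> p))"

definition shortest_path :: "'a complex_data \<Rightarrow> ('a \<Rightarrow> real) \<Rightarrow> 'a \<Rightarrow> 'a list \<Rightarrow> 'a \<Rightarrow> bool" where
  "shortest_path K \<omega> v p w \<longleftrightarrow>
     vertex_path K v p w \<and> ereal (path_length K \<omega> p) = path_dist K \<omega> v w"

definition nondegenerate :: "'a complex_data \<Rightarrow> ('a \<Rightarrow> real) \<Rightarrow> bool" where
  "nondegenerate K \<omega> \<longleftrightarrow>
     (\<forall>x v w. joins K x v w \<longrightarrow> (\<forall>p. shortest_path K \<omega> v p w \<longleftrightarrow> p = [v, w]))"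


subsection \<open>Forman curvature and the dual problem\<close>

definition forman :: "'a complex_data \<Rightarrow> ('a \<Rightarrow> real) \<Rightarrow> 'a \<Rightarrow> real" where
  "forman K \<omega> x = hodge K (ind x) x -
     (\<Sum>y\<in>all_cells K - {x}. \<omega> y / \<omega> x * \<bar>hodge K (ind y) x\<bar>)"

definition norm1 :: "'a complex_data \<Rightarrow> ('a \<Rightarrow> real) \<Rightarrow> ('a \<Rightarrow> real) \<Rightarrow> real" where
  "norm1 K \<omega> f = (\<Sum>x\<in>all_cells K. weight K x * \<omega> x * \<bar>f x\<bar>)"

definition dual_feasible ::
  "'a complex_data \<Rightarrow> nat \<Rightarrow> ('a \<Rightarrow> real) \<Rightarrow> (('a \<Rightarrow> real) \<Rightarrow> ('a \<Rightarrow> real)) \<Rightarrow> bool" where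
  "dual_feasible K k \<omega> J \<longleftrightarrow>
     linear_operator_on (cells K k) J \<and>
     (\<forall>x\<in>cells K k. \<forall>f\<in>fun_space (cells K k).
        2 * inner_product K (ind x) (\<lambda>y. \<omega> y * f y) \<ge> norm1 K \<omega> f \<longrightarrow> J f x \<ge> 0) \<and>
     (\<forall>z\<in>cells K (k + 1). coboundary K (J (boundary K (ind z))) z \<le> 0) \<and>
     trace_on (cells K k) J = 1"


subsection \<open>Existence and uniqueness of the adjoint\<close>

lemma fun_space_expand:
  assumes "finite X" "f \<in> fun_space X"
  shows "f = (\<lambda>y. \<Sum>x\<in>X. f x * ind x y)"
proof
  fix y
  have "(\<Sum>x\<in>X. f x * ind x y) = (\<Sum>x\<in>X. if x = y then f x else 0)"
    by (rule sum.cong) (auto simp: indicator_def)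
  also have "\<dots> = f y"
    using assms by (auto simp: fun_space_def)
  finally show "f y = (\<Sum>x\<in>X. f x * ind x y)" ..
qed

lemma linear_operator_on_sum:
  assumes T: "linear_operator_on X T" and "finite A" and "A \<subseteq> X"
  shows "T (\<lambda>y. \<Sum>x\<in>A. c x * ind x y) = (\<lambda>y. \<Sum>x\<in>A. c x * T (ind x) y)"
  using \<open>finite A\<close> \<open>A \<subseteq> X\<close>
proof (induction A rule: finite_induct)
  case empty
  have "(\<lambda>_. 0) \<in> fun_space X"
    by (simp add: fun_space_def)
  moreover have "\<forall>c. \<forall>f\<in>fun_space X. T (\<lambda>x. c * f x) = (\<lambda>x. c * T f x)"
    using T unfolding linear_operator_on_def by blast
  ultimately have "T (\<lambda>x. 0 * 0) = (\<lambda>x. 0 * T (\<lambda>_. 0) x)"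
    by (rule bspec[OF spec[where x = 0], rotated])
  then show ?case by simp
next
  case (insert a A)
  have add: "\<forall>f\<in>fun_space X. \<forall>g\<in>fun_space X.
      T (\<lambda>x. f x + g x) = (\<lambda>x. T f x + T g x)"
    and scale: "\<forall>c. \<forall>f\<in>fun_space X. T (\<lambda>x. c * f x) = (\<lambda>x. c * T f x)"
    using T unfolding linear_operator_on_def by simp_all
  have 1: "ind a \<in> fun_space X"
    using insert.prems by (auto simp: fun_space_def indicator_def)
  then have 2: "(\<lambda>y. c a * ind a y) \<in> fun_space X"
    by (simp add: fun_space_def)
  have 3: "(\<lambda>y. \<Sum>x\<in>A. c x * ind x y) \<in> fun_space X"
    using insert.prems by (auto simp: fun_space_def indicator_def intro!: sum.neutral)
  have "T (\<lambda>y. \<Sum>x\<in>insert a A. c x * ind x y) =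
        T (\<lambda>y. c a * ind a y + (\<Sum>x\<in>A. c x * ind x y))"
    using insert.hyps by simp
  also have "\<dots> = (\<lambda>y. T (\<lambda>y. c a * ind a y) y + T (\<lambda>y. \<Sum>x\<in>A. c x * ind x y) y)"
    by (rule add[rule_format, OF 2 3])
  also have "T (\<lambda>y. c a * ind a y) = (\<lambda>y. c a * T (ind a) y)"
    by (rule scale[rule_format, OF 1])
  finally show ?case
    using insert by simp
qed

lemma boundary_adjoint:
  assumes K: "cell_complex K"
  shows "is_adjoint K (coboundary K) (boundary K)"
proof -
  let ?X = "all_cells K" and ?T = "coboundary K"
  have fin: "finite ?X" and T: "linear_operator_on ?X ?T" and m: "\<And>x. x \<in> ?X \<Longrightarrow> weight K x > 0"
    using K unfolding cell_complex_def by auto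
  define S where "S = (\<lambda>g x. if x \<in> ?X
    then (\<Sum>z\<in>?X. ?T (ind x) z * g z * weight K z) / weight K x else 0)"
  have "linear_operator_on ?X S"
    unfolding linear_operator_on_def S_def fun_space_def
    by (auto simp: fun_eq_iff algebra_simps sum.distrib add_divide_distrib sum_distrib_left)
  moreover have "inner_product K (?T f) g = inner_product K f (S g)" if "f \<in> fun_space ?X" for f g
  proof -
    have Tf: "?T f = (\<lambda>y. \<Sum>x\<in>?X. f x * ?T (ind x) y)"
      using linear_operator_on_sum[OF T fin subset_refl, of f] fun_space_expand[OF fin that] by simp
    have "inner_product K (?T f) g
        = (\<Sum>y\<in>?X. \<Sum>x\<in>?X. f x * ?T (ind x) y * g y * weight K y)"
      by (simp add: inner_product_def Tf sum_distrib_right)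
    also have "\<dots> = (\<Sum>x\<in>?X. \<Sum>y\<in>?X. f x * ?T (ind x) y * g y * weight K y)"
      by (rule sum.swap)
    also have "\<dots> = inner_product K f (S g)"
      unfolding inner_product_def
      by (rule sum.cong) (auto simp: S_def sum_distrib_left mult.assoc dest: m)
    finally show ?thesis .
  qed
  ultimately have "is_adjoint K ?T S"
    by (simp add: is_adjoint_def)
  then show ?thesis
    unfolding boundary_def by (rule someI[where P = "is_adjoint K ?T"])
qed

lemma adjoint_unique:
  assumes K: "cell_complex K" and S: "is_adjoint K T S" and S': "is_adjoint K T S'"
    and g: "g \<in> fun_space (all_cells K)"
  shows "S g = S' g"
proof
  fix x
  let ?X = "all_cells K"
  have fin: "finite ?X" and m: "\<And>x. x \<in> ?X \<Longrightarrow> weight K x > 0"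
    using K unfolding cell_complex_def by auto
  have ev: "inner_product K (ind x) h = h x * weight K x" if "x \<in> ?X" for h
  proof -
    have "inner_product K (ind x) h = (\<Sum>y\<in>?X. if y = x then h x * weight K x else 0)"
      unfolding inner_product_def by (rule sum.cong) (auto simp: indicator_def)
    then show ?thesis using that fin by simp
  qed
  show "S g x = S' g x"
  proof (cases "x \<in> ?X")
    case True
    then have "ind x \<in> fun_space ?X"
      by (auto simp: fun_space_def indicator_def)
    then have "inner_product K (ind x) (S g) = inner_product K (ind x) (S' g)"
      using S S' g unfolding is_adjoint_def by metis
    then show ?thesis
      using True m[OF True] by (simp add: ev)
  next
    case False
    have "S g \<in> fun_space ?X" "S' g \<in> fun_space ?X"
      using S S' g unfolding is_adjoint_def linear_operator_on_def by auto
    then show ?thesis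
      using False by (simp add: fun_space_def)
  qed
qed

end

theory Submission
  imports Defs
begin

text \<open>
  A complex \<open>K'\<close> between the \<open>k\<close>-skeleton and \<open>K\<close> enters the curvature of the \<open>k\<close>-cells only
  through its weights on the \<open>(k + 1)\<close>-cells, extended by \<open>0\<close> to the missing cells, and every
  \<open>c \<ge> 0\<close> on these cells arises in this way.  As a function of \<open>c\<close>, the smallest Forman curvature is
  a minimum of finitely many affine functions, so maximizing it is a linear program; writing \<open>J\<close> as
  the matrix \<open>P x y = J y x / m y\<close>, the operators of the dual problem are exactly the solutions of
  the dual program.  Strong duality follows from the Farkas lemma once the program is bounded, and it
  is: there is a nonzero \<open>f\<close> in \<open>C(X\<^sub>k)\<close> with \<open>\<delta> f = 0\<close> (a coboundary, or a constant if
  \<open>k = 0\<close>), and at a cell maximizing \<open>\<bar>f\<bar> / \<omega>\<close> the contribution of \<open>c\<close> to the curvature is at most \<open>0\<close>.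
\<close>

subsection \<open>Linear programming duality\<close>

text \<open>Induction on the rows avoids separation theorems and any closedness argument for cones.
  If the implication already follows from the rows in \<open>M\<close>, row \<open>k\<close> gets
  the multiplier 0. Otherwise some \<open>y\<close> satisfies these rows but has positive objective,
  and moving along \<open>y\<close> reduces the claim to \<open>M\<close> with modified
  rows.\<close>

lemma farkas_equality:
  fixes A :: "'i \<Rightarrow> 'j \<Rightarrow> real"
  assumes "finite M" "finite N"
    and "\<And>x. (\<forall>i\<in>M. (\<Sum>j\<in>N. A i j * x j) \<le> 0) \<Longrightarrow> (\<Sum>j\<in>N. b j * x j) \<le> 0"
  shows "\<exists>l. (\<forall>i\<in>M. 0 \<le> l i) \<and> (\<forall>j\<in>N. (\<Sum>i\<in>M. l i * A i j) = b j)"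
  using assms(1,3)
proof (induction M arbitrary: A b rule: finite_induct)
  case empty
  \<comment> \<open>Without rows every \<open>x\<close> is admissible; testing with
    \<open>x = b\<close> forces \<open>b\<close> to vanish on \<open>N\<close>.\<close>
  have "(\<Sum>j\<in>N. b j * b j) \<le> 0"
    using empty.prems[of b] by simp
  then have "(\<Sum>j\<in>N. b j * b j) = 0"
    by (intro antisym sum_nonneg) auto
  then have "\<forall>j\<in>N. b j * b j = 0"
    using assms(2) by (subst (asm) sum_nonneg_eq_0_iff) auto
  then show ?case by auto
next
  case (insert k M)
  show ?case
  proof (cases "\<forall>x. (\<forall>i\<in>M. (\<Sum>j\<in>N. A i j * x j) \<le> 0) \<longrightarrow> (\<Sum>j\<in>N. b j * x j) \<le> 0")
    case True
    then obtain l where l: "\<forall>i\<in>M. 0 \<le> l i" "\<forall>j\<in>N. (\<Sum>i\<in>M. l i * A i j) = b j"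
      using insert.IH[of A b] by metis
    have "(\<Sum>i\<in>insert k M. (l(k := 0)) i * A i j) = (\<Sum>i\<in>M. l i * A i j)" for j
      using insert.hyps by (auto intro!: sum.cong)
    with l show ?thesis
      by (intro exI[of _ "l(k := 0)"]) auto
  next
    case False
    then obtain y where y: "\<forall>i\<in>M. (\<Sum>j\<in>N. A i j * y j) \<le> 0" "(\<Sum>j\<in>N. b j * y j) > 0"
      by force
    define s where "s = (\<Sum>j\<in>N. A k j * y j)"
    \<comment> \<open>Otherwise \<open>y\<close> would satisfy row \<open>k\<close> as well and
      contradict the hypothesis for \<open>insert k M\<close>.\<close>
    have s: "s > 0"
      using insert.prems[of y] y unfolding s_def by force
    define r where "r i = (\<Sum>j\<in>N. A i j * y j) / s" for i
    define q where "q = (\<Sum>j\<in>N. b j * y j) / s"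
    text \<open>Projecting along \<open>y\<close> onto the kernel of the functional of row \<open>k\<close> eliminates that row.\<close>
    have proj: "(\<Sum>j\<in>N. g j * (x j - (\<Sum>j\<in>N. A k j * x j) / s * y j))
        = (\<Sum>j\<in>N. (g j - (\<Sum>j\<in>N. g j * y j) / s * A k j) * x j)" for g x
    proof -
      define u w where "u = (\<Sum>j\<in>N. A k j * x j)" and "w = (\<Sum>j\<in>N. g j * y j)"
      have "(\<Sum>j\<in>N. g j * (x j - u / s * y j)) = (\<Sum>j\<in>N. g j * x j) - u / s * w"
        by (simp add: w_def algebra_simps sum_subtractf sum_distrib_left)
      also have "\<dots> = (\<Sum>j\<in>N. g j * x j) - w / s * u"
        by simp
      also have "\<dots> = (\<Sum>j\<in>N. (g j - w / s * A k j) * x j)"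
        by (simp add: u_def algebra_simps sum_subtractf sum_distrib_left)
      finally show ?thesis
        unfolding u_def w_def .
    qed
    have "\<exists>l. (\<forall>i\<in>M. 0 \<le> l i) \<and>
        (\<forall>j\<in>N. (\<Sum>i\<in>M. l i * (A i j - r i * A k j)) = b j - q * A k j)"
    proof (rule insert.IH)
      fix x
      assume x: "\<forall>i\<in>M. (\<Sum>j\<in>N. (A i j - r i * A k j) * x j) \<le> 0"
      let ?x = "\<lambda>j. x j - (\<Sum>j\<in>N. A k j * x j) / s * y j"
      have "(\<Sum>j\<in>N. A k j * ?x j) = 0"
        using s by (subst proj) (simp add: s_def[symmetric])
      moreover have "\<forall>i\<in>M. (\<Sum>j\<in>N. A i j * ?x j) \<le> 0"
        using x by (subst proj) (simp add: r_def)
      ultimately have "(\<Sum>j\<in>N. b j * ?x j) \<le> 0"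
        by (intro insert.prems) simp
      then show "(\<Sum>j\<in>N. (b j - q * A k j) * x j) \<le> 0"
        by (subst (asm) proj) (simp add: q_def)
    qed
    then obtain l where l: "\<forall>i\<in>M. 0 \<le> l i"
        "\<forall>j\<in>N. (\<Sum>i\<in>M. l i * (A i j - r i * A k j)) = b j - q * A k j"
      by blast
    \<comment> \<open>All multiples of row \<open>k\<close> that the projection introduced are
      collected in one multiplier. It is positive because \<open>q > 0\<close> and each
      \<open>r i \<le> 0\<close> by the choice of \<open>y\<close>.\<close>
    define l' where "l' = l(k := q - (\<Sum>i\<in>M. l i * r i))"
    have "(\<Sum>i\<in>M. l i * r i) \<le> 0"
      using l(1) y(1) s by (intro sum_nonpos mult_nonneg_nonpos) (auto simp: r_def divide_nonpos_pos)
    moreover have "q > 0"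
      using y s by (simp add: q_def)
    ultimately have "\<forall>i\<in>insert k M. 0 \<le> l' i"
      using l(1) by (auto simp: l'_def)
    moreover have "(\<Sum>i\<in>insert k M. l' i * A i j) = b j" if "j \<in> N" for j
    proof -
      have "(\<Sum>i\<in>insert k M. l' i * A i j) =
          (q - (\<Sum>i\<in>M. l i * r i)) * A k j + (\<Sum>i\<in>M. l' i * A i j)"
        using insert.hyps by (simp add: l'_def)
      also have "(\<Sum>i\<in>M. l' i * A i j) = (\<Sum>i\<in>M. l i * A i j)"
        using insert.hyps by (intro sum.cong) (auto simp: l'_def)
      also have "(q - (\<Sum>i\<in>M. l i * r i)) * A k j + (\<Sum>i\<in>M. l i * A i j)
          = q * A k j + (\<Sum>i\<in>M. l i * (A i j - r i * A k j))"
        by (simp add: algebra_simps sum_subtractf sum_distrib_left)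
      finally show ?thesis
        using l(2) that by simp
    qed
    ultimately show ?thesis by blast
  qed
qed

text \<open>The sign conditions on \<open>x\<close> become identity rows, indexed by the right
  summand of \<open>M <+> N\<close>, and the equality version is applied to \<open>- x\<close>. The
  multipliers of the identity rows are the slack in the resulting equations; dropping them leaves
  inequalities.\<close>

lemma farkas_inequality:
  fixes A :: "'i \<Rightarrow> 'j \<Rightarrow> real"
  assumes "finite M" "finite N"
    and x: "\<And>x. \<lbrakk>\<forall>j\<in>N. 0 \<le> x j; \<forall>i\<in>M. 0 \<le> (\<Sum>j\<in>N. A i j * x j)\<rbrakk> \<Longrightarrow> 0 \<le> (\<Sum>j\<in>N. b j * x j)"
  shows "\<exists>l. (\<forall>i\<in>M. 0 \<le> l i) \<and> (\<forall>j\<in>N. (\<Sum>i\<in>M. l i * A i j) \<le> b j)"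
proof -
  define A' where "A' = case_sum A (\<lambda>i j. if i = j then 1 else 0)"
  have "\<exists>l. (\<forall>i\<in>M <+> N. 0 \<le> l i) \<and> (\<forall>j\<in>N. (\<Sum>i\<in>M <+> N. l i * A' i j) = b j)"
  proof (rule farkas_equality)
    fix x assume *: "\<forall>i\<in>M <+> N. (\<Sum>j\<in>N. A' i j * x j) \<le> 0"
    have "\<forall>j\<in>N. 0 \<le> - x j"
    proof
      fix j assume "j \<in> N"
      then have "(\<Sum>i\<in>N. A' (Inr j) i * x i) \<le> 0"
        using * by blast
      also have "(\<Sum>i\<in>N. A' (Inr j) i * x i) = (\<Sum>i\<in>N. if j = i then x i else 0)"
        by (intro sum.cong) (auto simp: A'_def)
      also have "\<dots> = x j"
        using \<open>j \<in> N\<close> \<open>finite N\<close> by simp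
      finally show "0 \<le> - x j" by simp
    qed
    moreover have "\<forall>i\<in>M. 0 \<le> (\<Sum>j\<in>N. A i j * - x j)"
    proof
      fix i assume "i \<in> M"
      then have "(\<Sum>j\<in>N. A' (Inl i) j * x j) \<le> 0"
        using * by blast
      then show "0 \<le> (\<Sum>j\<in>N. A i j * - x j)"
        by (simp add: A'_def sum_negf)
    qed
    ultimately have "0 \<le> (\<Sum>j\<in>N. b j * - x j)"
      by (rule x)
    then show "(\<Sum>j\<in>N. b j * x j) \<le> 0"
      by (simp add: sum_negf)
  qed (use assms in auto)
  then obtain l where l: "\<forall>i\<in>M <+> N. 0 \<le> l i" "\<forall>j\<in>N. (\<Sum>i\<in>M <+> N. l i * A' i j) = b j"
    by blast
  have "(\<Sum>i\<in>M. l (Inl i) * A i j) \<le> b j" if "j \<in> N" for j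
  proof -
    have "b j = (\<Sum>i\<in>M. l (Inl i) * A i j) + (\<Sum>i\<in>N. l (Inr i) * A' (Inr i) j)"
      using l(2) that assms(1,2) by (auto simp: sum.Plus A'_def)
    moreover have "0 \<le> (\<Sum>i\<in>N. l (Inr i) * A' (Inr i) j)"
      using l(1) by (intro sum_nonneg) (auto simp: A'_def)
    ultimately show ?thesis by linarith
  qed
  then show ?thesis
    using l(1) by (intro exI[of _ "\<lambda>i. l (Inl i)"]) auto
qed

text \<open>Turns Farkas multipliers into a probability vector. Quantifying over \<open>g\<close>
  lets every homogeneous inequality in the multipliers carry over at once.\<close>

lemma normalize_weights:
  fixes l :: "'i \<Rightarrow> real"
  assumes "finite M" "\<forall>i\<in>M. 0 \<le> l i" "0 < (\<Sum>i\<in>M. l i)"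
  shows "\<exists>l'. (\<forall>i\<in>M. 0 \<le> l' i) \<and> (\<Sum>i\<in>M. l' i) = 1 \<and>
    (\<forall>g. (\<Sum>i\<in>M. l' i * g i) = (\<Sum>i\<in>M. l i * g i) / (\<Sum>i\<in>M. l i))"
  using assms
  by (intro exI[of _ "\<lambda>i. l i / (\<Sum>i\<in>M. l i)"]) (auto simp: sum_divide_distrib[symmetric])

text \<open>Ville's theorem of the alternative: if no column mixture makes every row positive, some
  row mixture makes no column positive. An additional variable records a common lower bound for the
  rows, and the hypothesis says that this bound cannot be positive.\<close>

lemma ville:
  fixes A :: "'i \<Rightarrow> 'j \<Rightarrow> real"
  assumes "finite M" "M \<noteq> {}" "finite N"
    and x: "\<And>x. \<forall>j\<in>N. 0 \<le> x j \<Longrightarrow> \<exists>i\<in>M. (\<Sum>j\<in>N. A i j * x j) \<le> 0"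
  shows "\<exists>l. (\<forall>i\<in>M. 0 \<le> l i) \<and> (\<Sum>i\<in>M. l i) = 1 \<and> (\<forall>j\<in>N. (\<Sum>i\<in>M. l i * A i j) \<le> 0)"
proof -
  \<comment> \<open>The coordinate \<open>None\<close> carries the common lower bound: the row
    conditions read \<open>x None \<le> (\<Sum>j\<in>N. A i j * x (Some j))\<close>, and the
    objective is \<open>- x None\<close>.\<close>
  define N' where "N' = insert None (Some ` N)"
  define A' where "A' i = case_option (-1) (A i)" for i
  define b :: "'j option \<Rightarrow> real" where "b = case_option (-1) (\<lambda>_. 0)"
  have N': "(\<Sum>j\<in>N'. g j) = g None + (\<Sum>j\<in>N. g (Some j))" for g :: "'j option \<Rightarrow> real"
    using \<open>finite N\<close> by (simp add: N'_def sum.reindex)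
  have "\<exists>l. (\<forall>i\<in>M. 0 \<le> l i) \<and> (\<forall>j\<in>N'. (\<Sum>i\<in>M. l i * A' i j) \<le> b j)"
  proof (rule farkas_inequality)
    fix x assume *: "\<forall>j\<in>N'. 0 \<le> x j" "\<forall>i\<in>M. 0 \<le> (\<Sum>j\<in>N'. A' i j * x j)"
    from *(1) have "\<forall>j\<in>N. 0 \<le> x (Some j)"
      by (simp add: N'_def)
    then obtain i where "i \<in> M" "(\<Sum>j\<in>N. A i j * x (Some j)) \<le> 0"
      using x[of "\<lambda>j. x (Some j)"] by blast
    moreover from this(1) *(2) have "x None \<le> (\<Sum>j\<in>N. A i j * x (Some j))"
      by (auto simp: N' A'_def)
    ultimately show "0 \<le> (\<Sum>j\<in>N'. b j * x j)"
      by (simp add: N' b_def)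
  qed (use assms in \<open>auto simp: N'_def\<close>)
  then obtain l where l: "\<forall>i\<in>M. 0 \<le> l i" "\<forall>j\<in>N'. (\<Sum>i\<in>M. l i * A' i j) \<le> b j"
    by blast
  \<comment> \<open>This is the Farkas inequality for column \<open>None\<close>; it rules out the
    zero multiplier, so that \<open>l\<close> can be normalized.\<close>
  have "(\<Sum>i\<in>M. l i) \<ge> 1"
    using l(2) by (simp add: N'_def A'_def b_def sum_negf)
  then have pos: "(\<Sum>i\<in>M. l i) > 0"
    by simp
  have nonpos: "(\<Sum>i\<in>M. l i * A i j) \<le> 0" if "j \<in> N" for j
    using l(2) that by (simp add: N'_def A'_def b_def)
  obtain l' where "\<forall>i\<in>M. 0 \<le> l' i"
    "(\<Sum>i\<in>M. l' i) = 1" "\<And>g. (\<Sum>i\<in>M. l' i * g i) = (\<Sum>i\<in>M. l i * g i) / (\<Sum>i\<in>M. l i)"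
        using normalize_weights[OF \<open>finite M\<close> l(1) pos] by metis
  then show ?thesis
    using pos nonpos by (intro exI[of _ l']) (auto simp: divide_nonpos_pos)
qed

lemma weighted_average_ge:
  fixes l :: "'i \<Rightarrow> real"
  assumes "\<forall>i\<in>M. 0 \<le> l i" "(\<Sum>i\<in>M. l i) = 1" "\<And>i. i \<in> M \<Longrightarrow> t \<le> g i"
  shows "t \<le> (\<Sum>i\<in>M. l i * g i)"
proof -
  have "t = (\<Sum>i\<in>M. l i * t)"
    using assms(2) by (simp add: sum_distrib_right[symmetric])
  also have "\<dots> \<le> (\<Sum>i\<in>M. l i * g i)"
    using assms by (intro sum_mono mult_left_mono) auto
  finally show ?thesis .
qed

lemma maxmin_duality:
  fixes a :: "'i \<Rightarrow> real" and B :: "'i \<Rightarrow> 'j \<Rightarrow> real"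
  assumes M: "finite M" "M \<noteq> {}" and N: "finite N"
    and bounded: "\<And>c. \<forall>j\<in>N. 0 \<le> c j \<Longrightarrow> \<exists>i\<in>M. (\<Sum>j\<in>N. B i j * c j) \<le> 0"
  shows "\<exists>c l. (\<forall>j\<in>N. 0 \<le> c j) \<and> (\<forall>i\<in>M. 0 \<le> l i) \<and> (\<Sum>i\<in>M. l i) = 1 \<and>
    (\<forall>j\<in>N. (\<Sum>i\<in>M. l i * B i j) \<le> 0) \<and>
    (\<forall>i\<in>M. (\<Sum>i\<in>M. l i * a i) \<le> a i + (\<Sum>j\<in>N. B i j * c j))"
proof -
  define D where "D = {l. (\<forall>i\<in>M. 0 \<le> l i) \<and> (\<Sum>i\<in>M. l i) = 1 \<and> (\<forall>j\<in>N. (\<Sum>i\<in>M. l i * B i j) \<le> 0)}"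
  define v where "v = (INF l\<in>D. \<Sum>i\<in>M. l i * a i)"
  \<comment> \<open>The boundedness hypothesis is exactly the premise of \<open>ville\<close>, which
    provides a dual feasible point.\<close>
  have D_ne: "D \<noteq> {}"
    using ville[OF M N bounded] by (auto simp: D_def)
  have "Min (a ` M) \<le> (\<Sum>i\<in>M. l i * a i)" if "l \<in> D" for l
    using that M by (intro weighted_average_ge) (auto simp: D_def)
  then have bdd: "bdd_below ((\<lambda>l. \<Sum>i\<in>M. l i * a i) ` D)"
    by (auto simp: bdd_below_def)
  have v_le: "v \<le> (\<Sum>i\<in>M. l i * a i)" if "l \<in> D" for l
    unfolding v_def using bdd that by (rule cINF_lower)
  have weak: "t \<le> v" if c: "\<forall>j\<in>N. 0 \<le> c j" and t: "\<And>i. i \<in> M \<Longrightarrow> t \<le> a i + (\<Sum>j\<in>N. B i j * c j)" for c t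
    unfolding v_def
  proof (rule cINF_greatest[OF D_ne])
    fix l assume l: "l \<in> D"
    have "t \<le> (\<Sum>i\<in>M. l i * (a i + (\<Sum>j\<in>N. B i j * c j)))"
      using l t by (intro weighted_average_ge) (auto simp: D_def)
    also have "\<dots> = (\<Sum>i\<in>M. l i * a i) + (\<Sum>i\<in>M. \<Sum>j\<in>N. l i * B i j * c j)"
      by (simp add: algebra_simps sum.distrib sum_distrib_left)
    also have "(\<Sum>i\<in>M. \<Sum>j\<in>N. l i * B i j * c j) = (\<Sum>j\<in>N. (\<Sum>i\<in>M. l i * B i j) * c j)"
      by (subst sum.swap) (simp add: sum_distrib_right)
    also have "\<dots> \<le> 0"
      using l c by (intro sum_nonpos) (simp add: D_def mult_nonpos_nonneg)
    finally show "t \<le> (\<Sum>i\<in>M. l i * a i)" by simp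
  qed
  \<comment> \<open>Attainment of the primal value: Farkas is applied with rows and columns
    exchanged, so that its multipliers are the sought \<open>c\<close>. Its premise, after
    normalizing a nonzero \<open>l\<close>, says that no point of \<open>D\<close> has value below
    \<open>v\<close>.\<close>
  have "\<exists>c. (\<forall>j\<in>N. 0 \<le> c j) \<and> (\<forall>i\<in>M. (\<Sum>j\<in>N. c j * - B i j) \<le> a i - v)"
  proof (rule farkas_inequality[OF N M(1)])
    fix l assume l: "\<forall>i\<in>M. 0 \<le> l i" "\<forall>j\<in>N. 0 \<le> (\<Sum>i\<in>M. - B i j * l i)"
    show "0 \<le> (\<Sum>i\<in>M. (a i - v) * l i)"
    proof (cases "\<exists>i\<in>M. l i \<noteq> 0")
      case True
      then have pos: "(\<Sum>i\<in>M. l i) > 0"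
        using l(1) M by (metis order_le_less sum_nonneg sum_nonneg_eq_0_iff)
      obtain l' where l': "\<forall>i\<in>M. 0 \<le> l' i"
        "(\<Sum>i\<in>M. l' i) = 1" "\<And>g. (\<Sum>i\<in>M. l' i * g i) = (\<Sum>i\<in>M. l i * g i) / (\<Sum>i\<in>M. l i)"
        using normalize_weights[OF \<open>finite M\<close> l(1) pos] by metis
      have "\<forall>j\<in>N. (\<Sum>i\<in>M. l i * B i j) \<le> 0"
        using l(2) by (simp add: sum_negf mult.commute)
      then have "l' \<in> D"
        using l' pos by (simp add: D_def divide_nonpos_pos)
      from v_le[OF this] have "v \<le> (\<Sum>i\<in>M. l i * a i) / (\<Sum>i\<in>M. l i)"
        by (simp add: l')
      then have "v * (\<Sum>i\<in>M. l i) \<le> (\<Sum>i\<in>M. l i * a i)"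
        using pos by (simp add: field_simps)
      then show ?thesis
        by (simp add: algebra_simps sum_subtractf sum_distrib_left)
    qed simp
  qed
  then obtain c where c: "\<forall>j\<in>N. 0 \<le> c j" "\<forall>i\<in>M. (\<Sum>j\<in>N. c j * - B i j) \<le> a i - v"
    by blast
  define N' where "N' = insert None (Some ` N)"
  \<comment> \<open>Attainment of the dual value: with \<open>a i - v\<close> as an additional
    column, a solution of \<open>ville\<close> is a point of \<open>D\<close> of value at most
    \<open>v\<close>.\<close>
  define B' where "B' i = case_option (a i - v) (B i)" for i
  have N': "(\<Sum>j\<in>N'. g j) = g None + (\<Sum>j\<in>N. g (Some j))" for g :: "'j option \<Rightarrow> real"
    using N by (simp add: N'_def sum.reindex)
  have "\<exists>l. (\<forall>i\<in>M. 0 \<le> l i) \<and> (\<Sum>i\<in>M. l i) = 1 \<and> (\<forall>j\<in>N'. (\<Sum>i\<in>M. l i * B' i j) \<le> 0)"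
  proof (rule ville[OF M])
    fix x :: "'j option \<Rightarrow> real" assume x: "\<forall>j\<in>N'. 0 \<le> x j"
    show "\<exists>i\<in>M. (\<Sum>j\<in>N'. B' i j * x j) \<le> 0"
    \<comment> \<open>The entry \<open>x None\<close> homogenizes the primal problem: at 0 only a
      recession direction remains, which \<open>bounded\<close> handles, and otherwise division by
      it gives a genuine primal point.\<close>
    proof (cases "x None = 0")
      case True
      moreover have "\<forall>j\<in>N. 0 \<le> x (Some j)"
        using x by (simp add: N'_def)
      ultimately show ?thesis
        using bounded[of "\<lambda>j. x (Some j)"] by (simp add: N' B'_def)
    next
      case False
      with x have pos: "x None > 0"
        by (simp add: N'_def)
      show ?thesis
      proof (rule ccontr)
        assume "\<not> ?thesis"
        then have gt: "0 < (a i - v) * x None + (\<Sum>j\<in>N. B i j * x (Some j))" if "i \<in> M" for i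
          using that by (auto simp: N' B'_def not_le)
        define h where "h i = a i + (\<Sum>j\<in>N. B i j * (x (Some j) / x None))" for i
        have h: "v < h i" if "i \<in> M" for i
          using gt[OF that] pos by (simp add: h_def field_simps sum_divide_distrib[symmetric])
        \<comment> \<open>Weak duality bounds the smallest row value by \<open>v\<close>, while all
          row values exceed \<open>v\<close> and \<open>M\<close> is finite.\<close>
        have "Min (h ` M) \<le> v"
        proof (rule weak[of "\<lambda>j. x (Some j) / x None"])
          show "\<forall>j\<in>N. 0 \<le> x (Some j) / x None"
            using x pos by (simp add: N'_def)
          show "Min (h ` M) \<le> a i + (\<Sum>j\<in>N. B i j * (x (Some j) / x None))" if "i \<in> M" for i
            unfolding h_def[symmetric] using that M by simp
        qed
        moreover have "v < Min (h ` M)"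
          using h M by simp
        ultimately show False by simp
      qed
    qed
  qed (use N in \<open>simp add: N'_def\<close>)
  then obtain l where l: "\<forall>i\<in>M. 0 \<le> l i" "(\<Sum>i\<in>M. l i) = 1" "\<forall>j\<in>N'. (\<Sum>i\<in>M. l i * B' i j) \<le> 0"
    by blast
  have "(\<Sum>i\<in>M. l i * (a i - v)) \<le> 0"
    using l(3) by (simp add: N'_def B'_def)
  then have "(\<Sum>i\<in>M. l i * a i) \<le> v"
    using l(2) by (simp add: algebra_simps sum_subtractf sum_distrib_left[symmetric])
  then show ?thesis
    using c l by (intro exI[of _ c] exI[of _ l])
      (force simp: N'_def B'_def sum_negf mult.commute)
qed

subsection \<open>The matrix form of the dual problem\<close>

text \<open>Centre minus radius of the Gershgorin disc of row \<open>x\<close>, after column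
  \<open>y\<close> has been scaled by \<open>w y\<close>. For the symmetrized Hodge matrix this is
  the Forman curvature up to a positive factor.\<close>

definition gershgorin :: "'a set \<Rightarrow> ('a \<Rightarrow> real) \<Rightarrow> ('a \<Rightarrow> 'a \<Rightarrow> real) \<Rightarrow> 'a \<Rightarrow> real" where
  "gershgorin X w Q x = w x * Q x x - (\<Sum>y\<in>X - {x}. w y * \<bar>Q x y\<bar>)"

text \<open>The three clauses are the matrix forms of (a), (b) and (c). For positive
  \<open>w\<close>, the case \<open>x = y\<close> of the first clause also says that the diagonal is
  nonnegative.\<close>

definition dual_matrix ::
  "'a set \<Rightarrow> 'b set \<Rightarrow> ('a \<Rightarrow> real) \<Rightarrow> ('a \<Rightarrow> real) \<Rightarrow> ('a \<Rightarrow> 'b \<Rightarrow> real) \<Rightarrow> ('a \<Rightarrow> 'a \<Rightarrow> real) \<Rightarrow> bool" where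
  "dual_matrix X N m w E P \<longleftrightarrow>
     (\<forall>x\<in>X. \<forall>y\<in>X. \<bar>P x y\<bar> * w x \<le> P x x * w y) \<and>
     (\<forall>z\<in>N. (\<Sum>x\<in>X. \<Sum>y\<in>X. P x y * (E x z * E y z)) \<le> 0) \<and>
     (\<Sum>x\<in>X. m x * P x x) = 1"

text \<open>A strictly diagonally dominant matrix, here in the weighted sense, has trivial kernel.
  The row where dominance fails is the one maximizing \<open>\<bar>f\<bar> / w\<close>.\<close>

lemma gershgorin_nonpos_of_kernel:
  assumes X: "finite X" and w: "\<And>x. x \<in> X \<Longrightarrow> 0 < w x"
    and f: "\<exists>x\<in>X. f x \<noteq> 0" and Qf: "\<And>x. x \<in> X \<Longrightarrow> (\<Sum>y\<in>X. Q x y * f y) = 0"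
  shows "\<exists>x\<in>X. gershgorin X w Q x \<le> 0"
proof -
  define r where "r y = \<bar>f y\<bar> / w y" for y
  have "Max (r ` X) \<in> r ` X"
    using X f by (intro Max_in) auto
  then obtain x where x: "x \<in> X" "r x = Max (r ` X)"
    by auto
  have le: "r y \<le> r x" if "y \<in> X" for y
    using that X x by simp
  have pos: "0 < r x"
  proof -
    obtain y where "y \<in> X" "f y \<noteq> 0"
      using f by blast
    then have "0 < r y"
      using w by (simp add: r_def)
    with le[OF \<open>y \<in> X\<close>] show ?thesis by simp
  qed
  have abs_f: "\<bar>f y\<bar> = r y * w y" if "y \<in> X" for y
    using w[OF that] by (simp add: r_def)
  have "Q x x * f x = - (\<Sum>y\<in>X - {x}. Q x y * f y)"
    using Qf[OF x(1)] X x(1) by (simp add: sum.remove)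
  then have "\<bar>Q x x\<bar> * \<bar>f x\<bar> = \<bar>\<Sum>y\<in>X - {x}. Q x y * f y\<bar>"
    by (metis abs_minus_cancel abs_mult)
  also have "\<dots> \<le> (\<Sum>y\<in>X - {x}. \<bar>Q x y * f y\<bar>)"
    by (rule sum_abs)
  also have "\<dots> \<le> (\<Sum>y\<in>X - {x}. r x * (w y * \<bar>Q x y\<bar>))"
  proof (rule sum_mono)
    fix y assume y: "y \<in> X - {x}"
    have "\<bar>Q x y * f y\<bar> = r y * (w y * \<bar>Q x y\<bar>)"
      using y by (simp add: abs_mult abs_f)
    also have "\<dots> \<le> r x * (w y * \<bar>Q x y\<bar>)"
      using y w[of y] le[of y] by (intro mult_right_mono) auto
    finally show "\<bar>Q x y * f y\<bar> \<le> r x * (w y * \<bar>Q x y\<bar>)" .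
  qed
  finally have "r x * (w x * \<bar>Q x x\<bar>) \<le> r x * (\<Sum>y\<in>X - {x}. w y * \<bar>Q x y\<bar>)"
    using x(1) by (simp add: abs_f sum_distrib_left mult_ac)
  then have "w x * \<bar>Q x x\<bar> \<le> (\<Sum>y\<in>X - {x}. w y * \<bar>Q x y\<bar>)"
    using pos by simp
  moreover have "w x * Q x x \<le> w x * \<bar>Q x x\<bar>"
    using w[OF x(1)] by simp
  ultimately show ?thesis
    by (intro bexI[OF _ x(1)]) (simp add: gershgorin_def)
qed

text \<open>The first clause of \<open>dual_matrix\<close> bounds \<open>P x x / w x\<close> times
  the Gershgorin value of row \<open>x\<close> by the pairing of row \<open>x\<close> of
  \<open>P\<close> with the matrix. Summing over the rows uses the third clause on the left, and the
  second makes the contribution of \<open>c\<close> nonpositive.\<close>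

lemma dual_matrix_weak_duality:
  assumes X: "finite X" and w: "\<And>x. x \<in> X \<Longrightarrow> 0 < w x"
    and P: "dual_matrix X N m w E P" and c: "\<And>z. z \<in> N \<Longrightarrow> 0 \<le> c z"
    and m: "\<And>x. x \<in> X \<Longrightarrow> 0 < m x"
    and t: "\<And>x. x \<in> X \<Longrightarrow> t * (w x * m x) \<le> gershgorin X w (\<lambda>x y. A x y + (\<Sum>z\<in>N. c z * (E x z * E y z))) x"
  shows "t \<le> (\<Sum>x\<in>X. \<Sum>y\<in>X. P x y * A x y)"
proof -
  define Q where "Q = (\<lambda>x y. A x y + (\<Sum>z\<in>N. c z * (E x z * E y z)))"
  have Pabs: "\<bar>P x y\<bar> * w x \<le> P x x * w y" if "x \<in> X" "y \<in> X" for x y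
    using P that by (auto simp: dual_matrix_def)
  have row: "t * (m x * P x x) \<le> (\<Sum>y\<in>X. P x y * Q x y)" if x: "x \<in> X" for x
  proof -
    have "\<bar>P x x\<bar> \<le> P x x"
      using Pabs[OF x x] w[OF x] by simp
    then have "0 \<le> P x x" by simp
    have "t * (m x * P x x) = P x x / w x * (t * (w x * m x))"
      using w[OF x] by simp
    also have "\<dots> \<le> P x x / w x * gershgorin X w Q x"
      using t[OF x] \<open>0 \<le> P x x\<close> w[OF x] by (intro mult_left_mono) (auto simp: Q_def)
    also have "\<dots> = P x x * Q x x - (\<Sum>y\<in>X - {x}. P x x / w x * w y * \<bar>Q x y\<bar>)"
      using w[OF x] by (simp add: gershgorin_def right_diff_distrib sum_distrib_left mult.assoc)
    also have "\<dots> \<le> P x x * Q x x - (\<Sum>y\<in>X - {x}. - (P x y * Q x y))"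
    proof (intro diff_left_mono sum_mono)
      fix y assume y: "y \<in> X - {x}"
      have "- (P x y * Q x y) \<le> \<bar>P x y\<bar> * \<bar>Q x y\<bar>"
        by (metis abs_ge_minus_self abs_mult)
      also have "\<bar>P x y\<bar> \<le> P x x / w x * w y"
        using Pabs[OF x, of y] y w[OF x] by (simp add: field_simps)
      finally show "- (P x y * Q x y) \<le> P x x / w x * w y * \<bar>Q x y\<bar>"
        by (simp add: mult_right_mono)
    qed
    also have "\<dots> = (\<Sum>y\<in>X. P x y * Q x y)"
      using X x by (simp add: sum_negf sum.remove[of X x])
    finally show ?thesis .
  qed
  have "t = t * (\<Sum>x\<in>X. m x * P x x)"
    using P by (simp add: dual_matrix_def)
  also have "\<dots> \<le> (\<Sum>x\<in>X. \<Sum>y\<in>X. P x y * Q x y)"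
    unfolding sum_distrib_left by (intro sum_mono row)
  also have "\<dots> = (\<Sum>x\<in>X. \<Sum>y\<in>X. P x y * A x y) +
      (\<Sum>x\<in>X. \<Sum>y\<in>X. \<Sum>z\<in>N. c z * (P x y * (E x z * E y z)))"
    by (simp add: Q_def distrib_left sum.distrib sum_distrib_left mult_ac)
  also have "(\<Sum>x\<in>X. \<Sum>y\<in>X. \<Sum>z\<in>N. c z * (P x y * (E x z * E y z)))
      = (\<Sum>z\<in>N. c z * (\<Sum>x\<in>X. \<Sum>y\<in>X. P x y * (E x z * E y z)))"
    by (simp add: sum_distrib_left sum.swap[of _ N X])
  also have "\<dots> \<le> 0"
    using P c by (intro sum_nonpos) (simp add: dual_matrix_def mult_nonneg_nonpos)
  finally show ?thesis by simp
qed

text \<open>Each absolute value in the Gershgorin bound is a minimum over two signs, so the bound is a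
  minimum of finitely many linear functions, indexed by a row and a sign pattern.\<close>

lemma dual_matrix_strong_duality:
  fixes A :: "'a \<Rightarrow> 'a \<Rightarrow> real" and E :: "'a \<Rightarrow> 'b \<Rightarrow> real"
  assumes X: "finite X" and N: "finite N" and w: "\<And>x. x \<in> X \<Longrightarrow> 0 < w x"
    and m: "\<And>x. x \<in> X \<Longrightarrow> 0 < m x"
    and f: "\<exists>x\<in>X. f x \<noteq> 0" and Ef: "\<And>z. z \<in> N \<Longrightarrow> (\<Sum>x\<in>X. E x z * f x) = 0"
  shows "\<exists>c P. (\<forall>z\<in>N. 0 \<le> c z) \<and> dual_matrix X N m w E P \<and>
    (\<forall>x\<in>X. (\<Sum>x\<in>X. \<Sum>y\<in>X. P x y * A x y) * (w x * m x)
       \<le> gershgorin X w (\<lambda>x y. A x y + (\<Sum>z\<in>N. c z * (E x z * E y z))) x)"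
proof -
  \<comment> \<open>The sign at \<open>x\<close> is always positive, since the diagonal entry enters
    without absolute value. Taking for \<open>S\<close> the negative entries of a row realizes the
    Gershgorin bound.\<close>
  define \<sigma> :: "'a \<Rightarrow> 'a set \<Rightarrow> 'a \<Rightarrow> real" where "\<sigma> x S y = (if y = x \<or> y \<in> S then 1 else -1)" for x S y
  \<comment> \<open>Dividing by \<open>w x * m x\<close> gives the rows the scale of curvatures, so
    that their minimum is compared with one number.\<close>
  define \<tau> where "\<tau> x S y = \<sigma> x S y * w y / (w x * m x)" for x S y
  define M where "M = X \<times> Pow X"
  define a where "a = (\<lambda>(x, S). \<Sum>y\<in>X. \<tau> x S y * A x y)"
  define B where "B = (\<lambda>(x, S) z. \<Sum>y\<in>X. \<tau> x S y * (E x z * E y z))"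
  have wm: "0 < w x * m x" if "x \<in> X" for x
    using w m that by simp
  have pattern: "(\<Sum>y\<in>X. \<tau> x {y \<in> X. Q x y < 0} y * Q x y) = gershgorin X w Q x / (w x * m x)"
    if x: "x \<in> X" for x Q
  proof -
    have "(\<Sum>y\<in>X. \<sigma> x {y \<in> X. Q x y < 0} y * w y * Q x y)
        = w x * Q x x + (\<Sum>y\<in>X - {x}. - (w y * \<bar>Q x y\<bar>))"
      unfolding sum.remove[OF X x]
      by (intro arg_cong2[of _ _ _ _ "(+)"] sum.cong) (auto simp: \<sigma>_def)
    then show ?thesis
      by (simp add: gershgorin_def \<tau>_def sum_negf sum_divide_distrib[symmetric])
  qed
  have Bc: "(\<Sum>z\<in>N. B (x, S) z * c z) = (\<Sum>y\<in>X. \<tau> x S y * (\<Sum>z\<in>N. c z * (E x z * E y z)))" for x S c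
    unfolding B_def by (simp add: sum_distrib_left sum_distrib_right mult_ac) (rule sum.swap)
  have "\<exists>c l. (\<forall>z\<in>N. 0 \<le> c z) \<and> (\<forall>i\<in>M. 0 \<le> l i) \<and> (\<Sum>i\<in>M. l i) = 1 \<and>
    (\<forall>z\<in>N. (\<Sum>i\<in>M. l i * B i z) \<le> 0) \<and>
    (\<forall>i\<in>M. (\<Sum>i\<in>M. l i * a i) \<le> a i + (\<Sum>z\<in>N. B i z * c z))"
  proof (rule maxmin_duality)
    show "finite M" "M \<noteq> {}"
      using X f by (auto simp: M_def)
    fix c :: "'b \<Rightarrow> real"
    \<comment> \<open>Boundedness concerns only the part depending on \<open>c\<close>; this matrix
      annihilates \<open>f\<close> because each column of \<open>E\<close> is orthogonal to
      \<open>f\<close>.\<close>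
    define Q where "Q = (\<lambda>x y. \<Sum>z\<in>N. c z * (E x z * E y z))"
    have Qf: "(\<Sum>y\<in>X. Q x y * f y) = 0" for x
    proof -
      have "(\<Sum>y\<in>X. Q x y * f y) = (\<Sum>z\<in>N. \<Sum>y\<in>X. c z * E x z * (E y z * f y))"
        unfolding Q_def sum_distrib_right by (subst sum.swap) (simp add: mult_ac)
      also have "\<dots> = 0"
        unfolding sum_distrib_left[symmetric] by (simp add: Ef)
      finally show ?thesis .
    qed
    then have "\<exists>x\<in>X. gershgorin X w Q x \<le> 0"
      using X w f by (intro gershgorin_nonpos_of_kernel) auto
    then obtain x where x: "x \<in> X" "gershgorin X w Q x \<le> 0"
      by blast
    have "(\<Sum>z\<in>N. B (x, {y \<in> X. Q x y < 0}) z * c z) = gershgorin X w Q x / (w x * m x)"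
      unfolding Bc pattern[OF x(1), symmetric] Q_def ..
    also have "\<dots> \<le> 0"
      using x wm by (simp add: divide_nonpos_pos)
    finally show "\<exists>i\<in>M. (\<Sum>z\<in>N. B i z * c z) \<le> 0"
      using x(1) by (intro bexI[of _ "(x, {y \<in> X. Q x y < 0})"]) (auto simp: M_def)
  qed (rule N)
  then obtain c l where c: "\<forall>z\<in>N. 0 \<le> c z" and l: "\<forall>i\<in>M. 0 \<le> l i" "(\<Sum>i\<in>M. l i) = 1"
    and lB: "\<forall>z\<in>N. (\<Sum>i\<in>M. l i * B i z) \<le> 0"
    and la: "\<forall>i\<in>M. (\<Sum>i\<in>M. l i * a i) \<le> a i + (\<Sum>z\<in>N. B i z * c z)"
    by blast
  \<comment> \<open>The dual weights average the sign rows over all patterns. Entrywise domination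
    by the diagonal is then the triangle inequality, since only the diagonal has no sign
    cancellation.\<close>
  define P where "P x y = (\<Sum>S\<in>Pow X. l (x, S) * \<tau> x S y)" for x y
  have sumM: "(\<Sum>i\<in>M. l i * (case i of (x, S) \<Rightarrow> \<Sum>y\<in>X. \<tau> x S y * R x y)) = (\<Sum>x\<in>X. \<Sum>y\<in>X. P x y * R x y)" for R
  proof -
    have "(\<Sum>i\<in>M. l i * (case i of (x, S) \<Rightarrow> \<Sum>y\<in>X. \<tau> x S y * R x y))
        = (\<Sum>x\<in>X. \<Sum>S\<in>Pow X. l (x, S) * (\<Sum>y\<in>X. \<tau> x S y * R x y))"
      unfolding M_def by (subst sum.cartesian_product) (simp add: case_prod_unfold)
    also have "\<dots> = (\<Sum>x\<in>X. \<Sum>y\<in>X. P x y * R x y)"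
    proof (rule sum.cong[OF refl])
      fix x
      show "(\<Sum>S\<in>Pow X. l (x, S) * (\<Sum>y\<in>X. \<tau> x S y * R x y)) = (\<Sum>y\<in>X. P x y * R x y)"
        unfolding P_def sum_distrib_left sum_distrib_right mult.assoc by (rule sum.swap)
    qed
    finally show ?thesis .
  qed
  have diag: "P x x = (\<Sum>S\<in>Pow X. l (x, S)) / m x" if "x \<in> X" for x
    using w[OF that] by (simp add: P_def \<tau>_def \<sigma>_def sum_divide_distrib)
  have "\<bar>P x y\<bar> * w x \<le> P x x * w y" if "x \<in> X" "y \<in> X" for x y
  proof -
    have "\<bar>P x y\<bar> \<le> (\<Sum>S\<in>Pow X. \<bar>l (x, S) * \<tau> x S y\<bar>)"
      unfolding P_def by (rule sum_abs)
    also have "\<dots> = (\<Sum>S\<in>Pow X. l (x, S) * (w y / (w x * m x)))"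
      using l(1) that w[OF that(1)] w[OF that(2)] m[OF that(1)]
      by (intro sum.cong) (auto simp: \<tau>_def \<sigma>_def M_def abs_mult)
    also have "\<dots> = P x x * w y / w x"
      unfolding sum_distrib_right[symmetric] by (simp add: diag[OF that(1)] mult.commute)
    finally show ?thesis
      using w[OF that(1)] by (simp add: field_simps)
  qed
  moreover have "(\<Sum>x\<in>X. \<Sum>y\<in>X. P x y * (E x z * E y z)) \<le> 0" if "z \<in> N" for z
    unfolding sumM[symmetric] using bspec[OF lB that] by (simp add: B_def case_prod_unfold)
  moreover have "(\<Sum>x\<in>X. m x * P x x) = 1"
  proof -
    have "(\<Sum>x\<in>X. m x * P x x) = (\<Sum>x\<in>X. \<Sum>S\<in>Pow X. l (x, S))"
      using m by (intro sum.cong) (auto simp: diag dest: m)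
    then show ?thesis
      using l(2) by (simp add: M_def sum.cartesian_product)
  qed
  ultimately have P: "dual_matrix X N m w E P"
    by (simp add: dual_matrix_def)
  have "(\<Sum>x\<in>X. \<Sum>y\<in>X. P x y * A x y) * (w x * m x)
      \<le> gershgorin X w (\<lambda>x y. A x y + (\<Sum>z\<in>N. c z * (E x z * E y z))) x" if x: "x \<in> X" for x
  proof -
    define Q where "Q = (\<lambda>x y. A x y + (\<Sum>z\<in>N. c z * (E x z * E y z)))"
    \<comment> \<open>Of all constraints for row \<open>x\<close>, the one for this pattern has the
      Gershgorin value of the full matrix on its right-hand side.\<close>
    let ?S = "{y \<in> X. Q x y < 0}"
    have "(x, ?S) \<in> M"
      using x by (auto simp: M_def)
    then have "(\<Sum>i\<in>M. l i * a i) \<le> a (x, ?S) + (\<Sum>z\<in>N. B (x, ?S) z * c z)"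
      using la by blast
    also have "\<dots> = (\<Sum>y\<in>X. \<tau> x ?S y * Q x y)"
      unfolding Bc by (simp add: a_def Q_def distrib_left sum.distrib)
    also have "\<dots> = gershgorin X w Q x / (w x * m x)"
      by (rule pattern[OF x])
    also have "(\<Sum>i\<in>M. l i * a i) = (\<Sum>x\<in>X. \<Sum>y\<in>X. P x y * A x y)"
      unfolding a_def by (rule sumM)
    finally show ?thesis
      using wm[OF x] unfolding Q_def by (simp add: pos_le_divide_eq)
  qed
  with c P show ?thesis by blast
qed

subsection \<open>The Hodge Laplacian in coordinates\<close>

abbreviation incidence :: "'a complex_data \<Rightarrow> 'a \<Rightarrow> 'a \<Rightarrow> real" where
  "incidence K v z \<equiv> coboundary K (ind v) z"

text \<open>The scalar product of the boundaries of \<open>x\<close> and \<open>y\<close>, that is,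
  the form of coboundary after boundary; the factor \<open>weight K x\<close> makes it
  symmetric.\<close>

definition down_form :: "'a complex_data \<Rightarrow> 'a \<Rightarrow> 'a \<Rightarrow> real" where
  "down_form K x y =
     weight K x * weight K y * (\<Sum>v\<in>all_cells K. incidence K v x * incidence K v y / weight K v)"

lemma ind_in_fun_space: "x \<in> A \<Longrightarrow> ind x \<in> fun_space A"
  by (auto simp: fun_space_def indicator_def)

lemma fun_space_mono: "A \<subseteq> B \<Longrightarrow> f \<in> fun_space A \<Longrightarrow> f \<in> fun_space B"
  by (auto simp: fun_space_def)

lemma linear_operator_on_apply:
  assumes "linear_operator_on X T" "finite A" "A \<subseteq> X" "f \<in> fun_space A"
  shows "T f y = (\<Sum>x\<in>A. f x * T (ind x) y)"
  using linear_operator_on_sum[OF assms(1-3), of f] fun_space_expand[OF assms(2,4)] by simp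

lemma cells_subset_all_cells: "cells K j \<subseteq> all_cells K"
  by (auto simp: all_cells_def)

lemma cell_in_all_cells: "x \<in> cells K j \<Longrightarrow> x \<in> all_cells K"
  using cells_subset_all_cells by (rule subsetD)

lemma all_cellsE:
  assumes "x \<in> all_cells K"
  obtains j where "x \<in> cells K j"
  using assms by (auto simp: all_cells_def)

context
  fixes K :: "'a complex_data"
  assumes K: "cell_complex K"
begin

lemma cells_disjoint: "\<forall>j k. j \<noteq> k \<longrightarrow> cells K j \<inter> cells K k = {}"
  and incidence_values: "\<forall>v\<in>all_cells K. \<forall>z\<in>all_cells K. incidence K v z \<in> {-1, 0, 1}"
  and incidence_dim: "\<forall>v\<in>all_cells K. \<forall>z\<in>all_cells K.
        int (cell_dim K z) - int (cell_dim K v) \<noteq> 1 \<longrightarrow> incidence K v z = 0"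
  and exists_facet: "\<forall>z\<in>all_cells K. cell_dim K z \<ge> 1 \<longrightarrow> (\<exists>x. facet K x z)"
  and edge_endpoints: "\<forall>x\<in>cells K 1. (\<exists>!w. w \<in> cells K 0 \<and> incidence K w x = 1) \<and>
                    (\<exists>!w. w \<in> cells K 0 \<and> incidence K w x = -1)"
  and diamond: "\<forall>v\<in>all_cells K. \<forall>z\<in>all_cells K.
        int (cell_dim K z) - int (cell_dim K v) = 2 \<and> between K v z \<noteq> {} \<longrightarrow>
          card (between K v z) = 2 \<and>
          {-1, 1} \<subseteq> (\<lambda>x. incidence K v x * incidence K x z) ` all_cells K"
  and facets_determine: "\<forall>z\<in>all_cells K. \<forall>z'\<in>all_cells K.
        {x. facet K x z} = {x. facet K x z'} \<and> cell_dim K z \<ge> 1 \<longrightarrow> z = z'"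
  using K unfolding cell_complex_def by - (elim conjE, assumption)+

lemma finite_all_cells: "finite (all_cells K)"
  using K by (simp add: cell_complex_def)

lemma finite_cells: "finite (cells K j)"
  using finite_subset[OF cells_subset_all_cells finite_all_cells] .

lemma weight_pos: "x \<in> all_cells K \<Longrightarrow> 0 < weight K x"
  using K by (simp add: cell_complex_def)

lemma linear_coboundary: "linear_operator_on (all_cells K) (coboundary K)"
  using K by (simp add: cell_complex_def)

lemma cells_unique: "x \<in> cells K i \<Longrightarrow> x \<in> cells K j \<Longrightarrow> i = j"
  using cells_disjoint by blast

lemma cell_dim_eq: "x \<in> cells K j \<Longrightarrow> cell_dim K x = j"
  unfolding cell_dim_def by (rule the_equality) (auto intro: cells_unique)

lemma incidence_nonzero_dim:
  assumes "v \<in> cells K i" "z \<in> cells K j" "incidence K v z \<noteq> 0"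
  shows "j = Suc i"
proof -
  have "v \<in> all_cells K" "z \<in> all_cells K"
    using assms by (auto intro: cell_in_all_cells)
  then have "int (cell_dim K z) - int (cell_dim K v) = 1"
    using incidence_dim assms(3) by blast
  then show ?thesis
    by (simp add: cell_dim_eq[OF assms(1)] cell_dim_eq[OF assms(2)])
qed

lemma coboundary_apply:
  "A \<subseteq> all_cells K \<Longrightarrow> f \<in> fun_space A \<Longrightarrow> coboundary K f y = (\<Sum>x\<in>A. f x * incidence K x y)"
  using linear_operator_on_apply[OF linear_coboundary] finite_subset[OF _ finite_all_cells] by blast

lemma inner_product_ind:
  assumes "x \<in> all_cells K"
  shows "inner_product K (ind x) g = weight K x * g x"
proof -
  have "inner_product K (ind x) g = (\<Sum>y\<in>all_cells K. if y = x then weight K x * g x else 0)"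
    unfolding inner_product_def by (rule sum.cong) (auto simp: indicator_def)
  then show ?thesis
    using assms finite_all_cells by simp
qed

text \<open>Since \<open>boundary\<close> is a chosen adjoint, its entries are read off by testing
  the adjoint identity on indicators.\<close>

lemma boundary_ind:
  assumes "x \<in> all_cells K" "z \<in> all_cells K"
  shows "boundary K (ind z) x = incidence K x z * weight K z / weight K x"
proof -
  have "inner_product K (ind x) (boundary K (ind z)) = inner_product K (coboundary K (ind x)) (ind z)"
    using boundary_adjoint[OF K] assms by (simp add: is_adjoint_def ind_in_fun_space)
  also have "\<dots> = inner_product K (ind z) (coboundary K (ind x))"
    by (simp add: inner_product_def mult.commute)
  finally have "weight K x * boundary K (ind z) x = incidence K x z * weight K z"
    using assms by (simp add: inner_product_ind mult.commute)
  then show ?thesis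
    using weight_pos[OF assms(1)] by (simp add: field_simps)
qed

lemma linear_boundary: "linear_operator_on (all_cells K) (boundary K)"
  using boundary_adjoint[OF K] by (simp add: is_adjoint_def)

lemma boundary_in_fun_space: "f \<in> fun_space (all_cells K) \<Longrightarrow> boundary K f \<in> fun_space (all_cells K)"
  using linear_boundary by (simp add: linear_operator_on_def)

lemma coboundary_in_fun_space: "f \<in> fun_space (all_cells K) \<Longrightarrow> coboundary K f \<in> fun_space (all_cells K)"
  using linear_coboundary by (simp add: linear_operator_on_def)

lemma coboundary_boundary_ind:
  assumes "x \<in> all_cells K" "y \<in> all_cells K"
  shows "coboundary K (boundary K (ind y)) x = down_form K x y / weight K x"
proof -
  have "coboundary K (boundary K (ind y)) x
      = (\<Sum>v\<in>all_cells K. boundary K (ind y) v * incidence K v x)"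
    using assms by (intro coboundary_apply boundary_in_fun_space ind_in_fun_space) auto
  also have "\<dots> = weight K y * (\<Sum>v\<in>all_cells K. incidence K v x * incidence K v y / weight K v)"
    using assms by (simp add: boundary_ind sum_distrib_left mult_ac)
  finally show ?thesis
    using weight_pos[OF assms(1)] by (simp add: down_form_def)
qed

lemma down_form_sym: "down_form K x y = down_form K y x"
  by (simp add: down_form_def mult_ac)

lemma boundary_coboundary_ind:
  assumes "x \<in> all_cells K" "y \<in> all_cells K"
  shows "boundary K (coboundary K (ind y)) x
    = (\<Sum>z\<in>all_cells K. weight K z * (incidence K x z * incidence K y z)) / weight K x"
proof -
  have "boundary K (coboundary K (ind y)) x = (\<Sum>z\<in>all_cells K. incidence K y z * boundary K (ind z) x)"
    using assms finite_all_cells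
    by (intro linear_operator_on_apply[OF linear_boundary] coboundary_in_fun_space ind_in_fun_space) auto
  also have "\<dots> = (\<Sum>z\<in>all_cells K. weight K z * (incidence K x z * incidence K y z)) / weight K x"
    using assms by (simp add: boundary_ind sum_divide_distrib mult_ac)
  finally show ?thesis .
qed

text \<open>After multiplication by \<open>weight K x\<close> the second summand is linear in the
  weights of the common cofaces, which is the source of the linear program.\<close>

lemma weight_hodge_ind:
  assumes "x \<in> all_cells K" "y \<in> all_cells K"
  shows "weight K x * hodge K (ind y) x
    = down_form K x y + (\<Sum>z\<in>all_cells K. weight K z * (incidence K x z * incidence K y z))"
  using weight_pos[OF assms(1)]
  by (simp add: hodge_def coboundary_boundary_ind[OF assms] boundary_coboundary_ind[OF assms] field_simps)

text \<open>A common face or a common coface determines the dimension of both cells. Hence only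
  cells of one dimension interact in the curvature.\<close>

lemma hodge_ind_eq_0:
  assumes "x \<in> cells K i" "y \<in> cells K j" "i \<noteq> j"
  shows "hodge K (ind y) x = 0"
proof -
  have xy: "x \<in> all_cells K" "y \<in> all_cells K"
    using assms by (auto intro: cell_in_all_cells)
  have down: "incidence K v x * incidence K v y = 0" and up: "incidence K x v * incidence K y v = 0"
    if "v \<in> all_cells K" for v
    using that incidence_nonzero_dim[of v _ x i] incidence_nonzero_dim[of v _ y j]
      incidence_nonzero_dim[of x i v] incidence_nonzero_dim[of y j v] assms
    by (metis all_cellsE mult_eq_0_iff nat.inject)+
  have "(\<Sum>v\<in>all_cells K. incidence K v x * incidence K v y / weight K v) = 0"
    by (intro sum.neutral ballI) (simp only: down div_0)
  moreover have "(\<Sum>z\<in>all_cells K. weight K z * (incidence K x z * incidence K y z)) = 0"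
    by (intro sum.neutral ballI) (simp only: up mult_zero_right)
  ultimately have "weight K x * hodge K (ind y) x = 0"
    by (simp add: weight_hodge_ind[OF xy] down_form_def)
  then show ?thesis
    using weight_pos[OF xy(1)] by simp
qed

text \<open>By the diamond axiom the nonzero terms are two in number, with opposite signs.\<close>

lemma coboundary_squared:
  assumes v: "v \<in> cells K j" and z: "z \<in> cells K (Suc (Suc j))"
  shows "(\<Sum>x\<in>cells K (Suc j). incidence K v x * incidence K x z) = 0"
proof -
  have vz: "v \<in> all_cells K" "z \<in> all_cells K"
    using assms by (auto intro: cell_in_all_cells)
  have between: "x \<in> between K v z \<longleftrightarrow> x \<in> all_cells K \<and> incidence K v x * incidence K x z \<noteq> 0" for x
    using vz by (auto simp: between_def facet_def)
  have "between K v z \<subseteq> cells K (Suc j)"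
    using incidence_nonzero_dim[OF v] by (auto simp: between elim!: all_cellsE)
  then have "(\<Sum>x\<in>cells K (Suc j). incidence K v x * incidence K x z)
      = (\<Sum>x\<in>between K v z. incidence K v x * incidence K x z)"
    using cells_subset_all_cells[of K "Suc j"] finite_cells
    by (intro sum.mono_neutral_right) (auto simp: between)
  also have "\<dots> = 0"
  proof (cases "between K v z = {}")
    case False
    have "int (cell_dim K z) - int (cell_dim K v) = 2"
      by (simp add: cell_dim_eq[OF v] cell_dim_eq[OF z])
    then have "card (between K v z) = 2 \<and> {-1, 1} \<subseteq> (\<lambda>x. incidence K v x * incidence K x z) ` all_cells K"
      using diamond[rule_format, OF vz] False by blast
    then have two: "card (between K v z) = 2"
      and signs: "{-1, 1} \<subseteq> (\<lambda>x. incidence K v x * incidence K x z) ` all_cells K"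
      by (rule conjunct1, rule conjunct2)
    have "-1 \<in> (\<lambda>x. incidence K v x * incidence K x z) ` all_cells K"
      "1 \<in> (\<lambda>x. incidence K v x * incidence K x z) ` all_cells K"
      using signs by blast+
    then obtain x y where x: "x \<in> all_cells K" "incidence K v x * incidence K x z = -1"
      and y: "y \<in> all_cells K" "incidence K v y * incidence K y z = 1"
      by (auto elim!: imageE)
    \<comment> \<open>The axiom only says that both signs occur; distinct products mean distinct
      cells, which therefore exhaust the two-element set.\<close>
    have "x \<noteq> y" "{x, y} \<subseteq> between K v z"
      using x y by (auto simp: between)
    with two have "between K v z = {x, y}"
      by (metis card_2_iff card_eq_0_iff card_subset_eq zero_neq_numeral)
    with \<open>x \<noteq> y\<close> x y show ?thesis by simp
  qed simp
  finally show ?thesis .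
qed

text \<open>Constants are cocycles on vertices, as an edge has one endpoint of each sign and all its
  other incidences vanish.\<close>

lemma incidence_edge_sum:
  assumes z: "z \<in> cells K (Suc 0)"
  shows "(\<Sum>x\<in>cells K 0. incidence K x z) = 0"
proof -
  have "z \<in> cells K 1"
    using z by simp
  then have ex: "\<exists>!w. w \<in> cells K 0 \<and> incidence K w z = 1" "\<exists>!w. w \<in> cells K 0 \<and> incidence K w z = -1"
    using edge_endpoints by blast+
  obtain p where p: "p \<in> cells K 0" "incidence K p z = 1"
    and p_unique: "\<And>w. w \<in> cells K 0 \<Longrightarrow> incidence K w z = 1 \<Longrightarrow> w = p"
    using ex(1) by blast
  obtain q where q: "q \<in> cells K 0" "incidence K q z = -1"
    and q_unique: "\<And>w. w \<in> cells K 0 \<Longrightarrow> incidence K w z = -1 \<Longrightarrow> w = q"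
    using ex(2) by blast
  have "incidence K x z = 0" if "x \<in> cells K 0 - {p, q}" for x
  proof -
    have "x \<in> all_cells K" "z \<in> all_cells K"
      using that z by (auto intro: cell_in_all_cells)
    then have "incidence K x z \<in> {-1, 0, 1}"
      using incidence_values by blast
    then show ?thesis
      using that p_unique q_unique by blast
  qed
  then have "(\<Sum>x\<in>cells K 0. incidence K x z) = (\<Sum>x\<in>{p, q}. incidence K x z)"
    using p q finite_cells by (intro sum.mono_neutral_right) auto
  also have "\<dots> = 0"
    using p q by (auto simp: sum.insert_if)
  finally show ?thesis .
qed

text \<open>Provides the kernel vector that bounds the linear program. On vertices a constant
  serves; in higher dimension, the coboundary of a face of some \<open>k\<close>-cell, which is
  nonzero at that cell.\<close>

lemma exists_cocycle:
  assumes "cells K k \<noteq> {}"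
  shows "\<exists>f. (\<exists>x\<in>cells K k. f x \<noteq> 0) \<and> (\<forall>z\<in>cells K (Suc k). (\<Sum>x\<in>cells K k. incidence K x z * f x) = 0)"
proof (cases k)
  case 0
  with assms show ?thesis
    by (intro exI[of _ "\<lambda>_. 1"]) (auto simp: incidence_edge_sum)
next
  case (Suc j)
  from assms obtain x where x: "x \<in> cells K k"
    by blast
  then have "x \<in> all_cells K" "cell_dim K x \<ge> 1"
    using Suc by (auto simp: cell_dim_eq intro: cell_in_all_cells)
  then obtain v where v: "v \<in> all_cells K" "incidence K v x \<noteq> 0"
    using exists_facet unfolding facet_def by blast
  then have "v \<in> cells K j"
    using incidence_nonzero_dim[OF _ x] Suc by (metis all_cellsE nat.inject)
  with x v Suc show ?thesis
    by (intro exI[of _ "incidence K v"]) (auto simp: coboundary_squared mult.commute[of "incidence K _ _" "incidence K v _"])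
qed

end

subsection \<open>Forman curvature of subcomplexes\<close>

text \<open>The symmetrized Hodge matrix on \<open>k\<close>-cells with the weights of the
  \<open>(k + 1)\<close>-cells replaced by a free vector \<open>c\<close>; an entry 0 encodes an
  absent cell.\<close>

definition curvature_form :: "'a complex_data \<Rightarrow> nat \<Rightarrow> ('a \<Rightarrow> real) \<Rightarrow> 'a \<Rightarrow> 'a \<Rightarrow> real" where
  "curvature_form K k c x y =
     down_form K x y + (\<Sum>z\<in>cells K (Suc k). c z * (incidence K x z * incidence K y z))"

definition subcomplex_coeff :: "nat \<Rightarrow> 'a complex_data \<Rightarrow> 'a \<Rightarrow> real" where
  "subcomplex_coeff k L z = (if z \<in> cells L (Suc k) then weight L z else 0)"

lemma subcomplex_coeff_nonneg: "cell_complex L \<Longrightarrow> 0 \<le> subcomplex_coeff k L z"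
  using weight_pos[of L z] cell_in_all_cells[of z L] by (auto simp: subcomplex_coeff_def)

context
  fixes K L :: "'a complex_data" and k :: nat
  assumes LK: "subcomplex_from k L K"
begin

lemma subcomplex_complexes: "cell_complex K" "cell_complex L"
  using LK by (simp_all add: subcomplex_from_def)

lemma subcomplex_cells_eq: "j \<le> k \<Longrightarrow> cells L j = cells K j"
  using LK by (simp add: subcomplex_from_def)

lemma subcomplex_cells_subset: "cells L j \<subseteq> cells K j"
  using LK by (cases "j \<le> k") (auto simp: subcomplex_from_def)

lemma subcomplex_all_cells_subset: "all_cells L \<subseteq> all_cells K"
  using subcomplex_cells_subset by (auto simp: all_cells_def)

lemma subcomplex_weight: "j \<le> k \<Longrightarrow> x \<in> cells K j \<Longrightarrow> weight L x = weight K x"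
  using LK by (auto simp: subcomplex_from_def)

lemma subcomplex_incidence:
  "v \<in> all_cells L \<Longrightarrow> x \<in> all_cells L \<Longrightarrow> incidence L v x = incidence K v x"
  using LK by (simp add: subcomplex_from_def)

lemma subcomplex_cell_dim: "x \<in> all_cells L \<Longrightarrow> x \<in> cells K j \<Longrightarrow> x \<in> cells L j"
  by (metis all_cellsE cells_unique subcomplex_complexes(1) subcomplex_cells_subset subsetD)

text \<open>Faces of \<open>k\<close>-cells lie in the common skeleton with common weights, so the
  part through faces is that of \<open>K\<close>. The part through cofaces sees only
  \<open>(k + 1)\<close>-cells, where \<open>subcomplex_coeff\<close> accounts for both changed
  weights and missing cells.\<close>

lemma weight_hodge_subcomplex:
  assumes x: "x \<in> cells K k" and y: "y \<in> cells K k"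
  shows "weight K x * hodge L (ind y) x = curvature_form K k (subcomplex_coeff k L) x y"
proof -
  note [simp] = subcomplex_incidence
  have in_L: "x \<in> all_cells L" "y \<in> all_cells L"
    using x y subcomplex_cells_eq[of k] cell_in_all_cells[of _ L k] by auto
  have fin: "finite (all_cells K)" "finite (all_cells L)" "finite (cells K (Suc k))"
    using subcomplex_complexes by (auto intro: finite_all_cells finite_cells)
  have face: "v \<in> cells L i \<and> i < k" if "v \<in> cells K i" "incidence K v x \<noteq> 0" for v i
    using incidence_nonzero_dim[OF subcomplex_complexes(1) that(1) x that(2)] that subcomplex_cells_eq[of i]
    by auto
  have coface: "z \<in> cells K (Suc k)" if "z \<in> all_cells K" "incidence K x z \<noteq> 0" for z
    using incidence_nonzero_dim[OF subcomplex_complexes(1) x _ that(2)] that(1) by (auto elim!: all_cellsE)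
  have "(\<Sum>v\<in>all_cells L. incidence L v x * incidence L v y / weight L v)
      = (\<Sum>v\<in>all_cells K. incidence K v x * incidence K v y / weight K v)"
  proof (rule sum.mono_neutral_cong)
    \<comment> \<open>A cell missing from \<open>L\<close> has dimension above \<open>k\<close>, so
      it is no face of \<open>x\<close>.\<close>
    fix v assume v: "v \<in> all_cells K - all_cells L"
    then have "incidence K v x = 0"
      using face cell_in_all_cells by (metis DiffE all_cellsE)
    then show "incidence K v x * incidence K v y / weight K v = 0" by simp
  next
    fix v assume v: "v \<in> all_cells L \<inter> all_cells K"
    then obtain i where i: "v \<in> cells K i"
      by (auto elim: all_cellsE)
    \<comment> \<open>The weights of \<open>K\<close> and \<open>L\<close> may differ only above
      dimension \<open>k\<close>, where no face of \<open>x\<close> lies.\<close>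
    have "incidence K v x = 0 \<or> weight L v = weight K v"
      using face[OF i] subcomplex_weight[OF _ i] by (metis less_imp_le)
    then show "incidence L v x * incidence L v y / weight L v = incidence K v x * incidence K v y / weight K v"
      using v in_L by auto
  qed (use fin subcomplex_all_cells_subset in auto)
  moreover have "(\<Sum>z\<in>all_cells L. weight L z * (incidence L x z * incidence L y z))
      = (\<Sum>z\<in>cells K (Suc k). subcomplex_coeff k L z * (incidence K x z * incidence K y z))"
  proof (rule sum.mono_neutral_cong)
    fix z assume "z \<in> cells K (Suc k) - all_cells L"
    then show "subcomplex_coeff k L z * (incidence K x z * incidence K y z) = 0"
      using cell_in_all_cells[of z L] by (auto simp: subcomplex_coeff_def)
  next
    fix z assume "z \<in> all_cells L - cells K (Suc k)"
    then show "weight L z * (incidence L x z * incidence L y z) = 0"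
      using coface[of z] in_L subcomplex_all_cells_subset by auto
  next
    fix z assume "z \<in> all_cells L \<inter> cells K (Suc k)"
    then show "weight L z * (incidence L x z * incidence L y z)
        = subcomplex_coeff k L z * (incidence K x z * incidence K y z)"
      using in_L subcomplex_cell_dim by (simp add: subcomplex_coeff_def)
  qed (use fin in auto)
  ultimately show ?thesis
    using weight_hodge_ind[OF subcomplex_complexes(2) in_L] subcomplex_weight[OF order_refl] x y
    by (simp add: curvature_form_def down_form_def)
qed

text \<open>The factor \<open>\<omega> x * weight K x\<close> clears both denominators, that of the
  quotient of lengths and that of the Hodge matrix; cells of other dimensions drop out by
  \<open>hodge_ind_eq_0\<close>.\<close>

lemma forman_subcomplex:
  assumes x: "x \<in> cells K k" and \<omega>: "0 < \<omega> x"
  shows "forman L \<omega> x * (\<omega> x * weight K x)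
    = gershgorin (cells K k) \<omega> (curvature_form K k (subcomplex_coeff k L)) x"
proof -
  let ?C = "curvature_form K k (subcomplex_coeff k L)"
  have m: "0 < weight K x"
    using x subcomplex_complexes by (auto intro: weight_pos cell_in_all_cells)
  have hodge: "hodge L (ind y) x = ?C x y / weight K x" if "y \<in> cells K k" for y
    using weight_hodge_subcomplex[OF x that] m by (simp add: field_simps)
  have "(\<Sum>y\<in>all_cells L - {x}. \<omega> y / \<omega> x * \<bar>hodge L (ind y) x\<bar>)
      = (\<Sum>y\<in>cells K k - {x}. \<omega> y / \<omega> x * \<bar>hodge L (ind y) x\<bar>)"
  proof (rule sum.mono_neutral_right)
    show "\<forall>y\<in>all_cells L - {x} - (cells K k - {x}). \<omega> y / \<omega> x * \<bar>hodge L (ind y) x\<bar> = 0"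
    proof
      fix y assume y: "y \<in> all_cells L - {x} - (cells K k - {x})"
      then obtain j where "y \<in> cells L j" "j \<noteq> k"
        using subcomplex_cells_eq[of k] by (auto elim!: all_cellsE)
      then show "\<omega> y / \<omega> x * \<bar>hodge L (ind y) x\<bar> = 0"
        using hodge_ind_eq_0[OF subcomplex_complexes(2), of x k y j] x subcomplex_cells_eq[of k] by simp
    qed
    show "cells K k - {x} \<subseteq> all_cells L - {x}"
      using subcomplex_cells_eq[of k] cell_in_all_cells[of _ L k] by auto
  qed (use finite_all_cells[OF subcomplex_complexes(2)] in auto)
  also have "\<dots> = (\<Sum>y\<in>cells K k - {x}. \<omega> y * \<bar>?C x y\<bar>) / (\<omega> x * weight K x)"
    using m by (simp add: hodge sum_divide_distrib)
  finally show ?thesis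
    using \<omega> m by (simp add: forman_def gershgorin_def hodge[OF x] field_simps)
qed

end

section \<open>Subcomplexes realizing a prescribed coefficient vector\<close>

text \<open>All cells above dimension \<open>k + 1\<close> are discarded, so removing
  \<open>(k + 1)\<close>-cells leaves no cell with a missing face. The coboundary is cut off in
  order to map into the smaller function space.\<close>

definition reweighted_skeleton :: "nat \<Rightarrow> ('a \<Rightarrow> real) \<Rightarrow> 'a complex_data \<Rightarrow> 'a complex_data" where
  "reweighted_skeleton k c K =
     (let X = \<lambda>j. if j \<le> k then cells K j else if j = Suc k then {z \<in> cells K j. 0 < c z} else {}
      in \<lparr>cells = X,
          coboundary = (\<lambda>f x. if x \<in> (\<Union>j. X j) then coboundary K f x else 0),
          weight = (\<lambda>x. if x \<in> cells K (Suc k) then c x else weight K x)\<rparr>)"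

lemma cells_reweighted_skeleton:
  "cells (reweighted_skeleton k c K) j =
     (if j \<le> k then cells K j else if j = Suc k then {z \<in> cells K j. 0 < c z} else {})"
  by (simp add: reweighted_skeleton_def Let_def)

lemma coboundary_reweighted_skeleton:
  "coboundary (reweighted_skeleton k c K) f x =
     (if x \<in> all_cells (reweighted_skeleton k c K) then coboundary K f x else 0)"
  by (simp only: reweighted_skeleton_def Let_def all_cells_def complex_data.simps)

lemma weight_reweighted_skeleton:
  "weight (reweighted_skeleton k c K) x = (if x \<in> cells K (Suc k) then c x else weight K x)"
  by (simp add: reweighted_skeleton_def Let_def)

text \<open>The remaining cells are closed under passing to faces, and so facets, dimensions and the
  sets \<open>between\<close> agree with those of \<open>K\<close>. The axioms about them are then
  inherited; only positivity of the weights and connectedness need separate arguments.\<close>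

lemma reweighted_skeleton_subcomplex:
  assumes K: "cell_complex K"
  shows "subcomplex_from k (reweighted_skeleton k c K) K"
proof -
  define L where "L = reweighted_skeleton k c K"
  note cells_L = cells_reweighted_skeleton[of k c K, folded L_def]
  note cob_L = coboundary_reweighted_skeleton[of k c K, folded L_def]
  note weight_L = weight_reweighted_skeleton[of k c K, folded L_def]
  have sub: "cells L j \<subseteq> cells K j" for j
    by (auto simp: cells_L)
  have all_sub: "all_cells L \<subseteq> all_cells K"
    using sub by (auto simp: all_cells_def)
  have inc: "incidence L v z = incidence K v z" if "z \<in> all_cells L" for v z
    using that by (simp add: cob_L)
  have dim_unique: "i = j" if "x \<in> cells L i" "x \<in> cells K j" for x i j
    using cells_unique[OF K] subsetD[OF sub that(1)] that(2) .
  have dim: "cell_dim L z = cell_dim K z" if "z \<in> all_cells L" for z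
  proof -
    obtain j where j: "z \<in> cells L j"
      using \<open>z \<in> all_cells L\<close> by (rule all_cellsE)
    then have "cell_dim L z = j"
      unfolding cell_dim_def using sub by (intro the_equality) (metis dim_unique subsetD)+
    with cell_dim_eq[OF K subsetD[OF sub j]] show ?thesis
      by simp
  qed
  have facet_L: "facet L x z \<longleftrightarrow> facet K x z" if z: "z \<in> all_cells L" for x z
  proof
    assume "facet K x z"
    then have x: "x \<in> all_cells K" "incidence K x z \<noteq> 0"
      by (auto simp: facet_def)
    obtain i j where i: "x \<in> cells K i" and j: "z \<in> cells L j"
      using x(1) z by (auto elim!: all_cellsE)
    then have "j = Suc i"
      using incidence_nonzero_dim[OF K i subsetD[OF sub j] x(2)] by simp
    \<comment> \<open>Cells of \<open>L\<close> have dimension at most \<open>k + 1\<close>, so a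
      face has dimension at most \<open>k\<close>, where nothing was removed.\<close>
    then have "x \<in> cells L i"
      using i j by (auto simp: cells_L split: if_splits)
    then show "facet L x z"
      using x z by (auto simp: facet_def inc intro: cell_in_all_cells)
  qed (use z all_sub in \<open>auto simp: facet_def inc\<close>)
  have facet_closed: "x \<in> all_cells L" if "z \<in> all_cells L" "facet K x z" for x z
    using that facet_L by (auto simp: facet_def)
  have between_L: "between L v z = between K v z" if "z \<in> all_cells L" for v z
    using that by (auto simp: between_def facet_L dest: facet_closed)
  have "finite (all_cells L)"
    using all_sub finite_all_cells[OF K] by (rule finite_subset)
  moreover have "\<forall>i j. i \<noteq> j \<longrightarrow> cells L i \<inter> cells L j = {}"
    using sub by (metis dim_unique disjoint_iff subsetD)
  moreover have "linear_operator_on (all_cells L) (coboundary L)"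
  proof -
    have "fun_space (all_cells L) \<subseteq> fun_space (all_cells K)"
      using all_sub fun_space_mono by blast
    then show ?thesis
      using linear_coboundary[OF K] unfolding linear_operator_on_def
      by (auto simp: cob_L fun_eq_iff fun_space_def[of "all_cells L"] subset_eq)
  qed
  moreover have "\<forall>x\<in>all_cells L. weight L x > 0"
  proof
    fix x assume x: "x \<in> all_cells L"
    then obtain i where i: "x \<in> cells L i"
      by (rule all_cellsE)
    \<comment> \<open>On the \<open>(k + 1)\<close>-cells the weight is \<open>c\<close>, and only
      cells with positive \<open>c\<close> were kept.\<close>
    show "weight L x > 0"
    proof (cases "x \<in> cells K (Suc k)")
      case True
      then have "i = Suc k"
        using dim_unique[OF i] by simp
      with i show ?thesis
        by (simp add: weight_L cells_L)
    next
      case False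
      then show ?thesis
        using x all_sub weight_pos[OF K] by (auto simp: weight_L)
    qed
  qed
  moreover have "\<forall>v\<in>all_cells L. \<forall>z\<in>all_cells L. incidence L v z \<in> {-1, 0, 1}"
    using incidence_values[OF K] all_sub inc by (metis subsetD)
  moreover have "\<forall>v\<in>all_cells L. \<forall>z\<in>all_cells L.
      int (cell_dim L z) - int (cell_dim L v) \<noteq> 1 \<longrightarrow> incidence L v z = 0"
    using incidence_dim[OF K] all_sub inc dim by (metis subsetD)
  moreover have "\<forall>z\<in>all_cells L. cell_dim L z \<ge> 1 \<longrightarrow> (\<exists>x. facet L x z)"
    using exists_facet[OF K] all_sub dim facet_L by (metis subsetD)
  moreover have "\<forall>x\<in>cells L 1. (\<exists>!w. w \<in> cells L 0 \<and> incidence L w x = 1) \<and>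
      (\<exists>!w. w \<in> cells L 0 \<and> incidence L w x = -1)"
  proof
    fix x assume x: "x \<in> cells L 1"
    then have "x \<in> cells K 1" "x \<in> all_cells L" "cells L 0 = cells K 0"
      using sub by (auto simp: cells_L intro: cell_in_all_cells)
    then show "(\<exists>!w. w \<in> cells L 0 \<and> incidence L w x = 1) \<and>
        (\<exists>!w. w \<in> cells L 0 \<and> incidence L w x = -1)"
      using edge_endpoints[OF K] by (simp add: inc)
  qed
  moreover have "\<forall>v\<in>all_cells L. \<forall>z\<in>all_cells L.
      int (cell_dim L z) - int (cell_dim L v) = 2 \<and> between L v z \<noteq> {} \<longrightarrow>
        card (between L v z) = 2 \<and>
        {-1, 1} \<subseteq> (\<lambda>x. incidence L v x * incidence L x z) ` all_cells L"
  proof (intro ballI impI)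
    fix v z assume v: "v \<in> all_cells L" and z: "z \<in> all_cells L"
      and vz: "int (cell_dim L z) - int (cell_dim L v) = 2 \<and> between L v z \<noteq> {}"
    have vz_K: "v \<in> all_cells K" "z \<in> all_cells K"
      using v z all_sub by blast+
    from vz have *: "card (between K v z) = 2 \<and>
        {-1, 1} \<subseteq> (\<lambda>x. incidence K v x * incidence K x z) ` all_cells K"
      using diamond[OF K, rule_format, OF vz_K] by (simp add: dim v z between_L)
    \<comment> \<open>A nonzero product can only come from a facet of \<open>z\<close>, and facets
      of cells of \<open>L\<close> stay in \<open>L\<close>.\<close>
    have "s \<in> (\<lambda>x. incidence L v x * incidence L x z) ` all_cells L"
      if s: "s \<noteq> 0" "s \<in> (\<lambda>x. incidence K v x * incidence K x z) ` all_cells K" for s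
    proof -
      obtain x where x: "x \<in> all_cells K" "s = incidence K v x * incidence K x z"
        using s(2) by blast
      with s(1) have "facet K x z"
        using vz_K by (auto simp: facet_def)
      then have "x \<in> all_cells L"
        using z facet_closed by blast
      with x show ?thesis
        using z by (intro image_eqI[of _ _ x]) (simp_all add: inc)
    qed
    with * show "card (between L v z) = 2 \<and>
        {-1, 1} \<subseteq> (\<lambda>x. incidence L v x * incidence L x z) ` all_cells L"
      by (simp add: between_L z)
  qed
  moreover have "\<forall>z\<in>all_cells L. \<forall>x y. facet L x z \<and> facet L y z \<longrightarrow>
      (\<exists>p. p \<noteq> [] \<and> hd p = x \<and> last p = y \<and> set p \<subseteq> all_cells L \<and>
         successively (\<lambda>a b. incidence L b a + incidence L a b \<noteq> 0) p)"
  proof (intro ballI allI impI)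
    fix z x y assume z: "z \<in> all_cells L" and xy: "facet L x z \<and> facet L y z"
    \<comment> \<open>The connecting sequence is \<open>x\<close>, \<open>z\<close>,
      \<open>y\<close>. Its incidence sums cannot cancel, because one of the two summands is 0 for
      dimension reasons.\<close>
    have nz: "incidence L z u = 0" "incidence L u z \<noteq> 0" "u \<in> all_cells L" if "facet L u z" for u
    proof -
      show u: "incidence L u z \<noteq> 0" "u \<in> all_cells L"
        using that by (auto simp: facet_def)
      obtain i j where "u \<in> cells K i" "z \<in> cells K j"
        using u z all_sub by (metis all_cellsE subsetD)
      then show "incidence L z u = 0"
        using u z incidence_nonzero_dim[OF K, of u i z j] incidence_nonzero_dim[OF K, of z j u i]
        by (auto simp: inc)
    qed
    show "\<exists>p. p \<noteq> [] \<and> hd p = x \<and> last p = y \<and> set p \<subseteq> all_cells L \<and>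
         successively (\<lambda>a b. incidence L b a + incidence L a b \<noteq> 0) p"
      using xy z by (intro exI[of _ "[x, z, y]"]) (auto simp: nz)
  qed
  moreover have "\<forall>z\<in>all_cells L. \<forall>z'\<in>all_cells L.
      {x. facet L x z} = {x. facet L x z'} \<and> cell_dim L z \<ge> 1 \<longrightarrow> z = z'"
    using facets_determine[OF K] all_sub by (auto simp: facet_L dim)
  ultimately have "cell_complex L"
    unfolding cell_complex_def by (intro conjI)
  moreover have "weight K x = weight L x" if "j \<le> k" "x \<in> cells K j" for x j
    using that cells_unique[OF K, of x j "Suc k"] by (auto simp: weight_L)
  ultimately show ?thesis
    using K sub inc unfolding subcomplex_from_def L_def[symmetric] by (auto simp: cells_L)
qed

lemma subcomplex_coeff_reweighted_skeleton:
  "z \<in> cells K (Suc k) \<Longrightarrow> 0 \<le> c z \<Longrightarrow> subcomplex_coeff k (reweighted_skeleton k c K) z = c z"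
  by (simp add: subcomplex_coeff_def cells_reweighted_skeleton weight_reweighted_skeleton)

subsection \<open>Operators and matrices\<close>

text \<open>The kernel of \<open>J\<close> with respect to the measure \<open>weight K\<close>.
  Dividing by the weight of the argument makes the weights cancel in the trace formula
  below.\<close>

definition operator_matrix :: "'a complex_data \<Rightarrow> (('a \<Rightarrow> real) \<Rightarrow> ('a \<Rightarrow> real)) \<Rightarrow> 'a \<Rightarrow> 'a \<Rightarrow> real" where
  "operator_matrix K J x y = J (ind y) x / weight K y"

context
  fixes K :: "'a complex_data" and k :: nat and J :: "('a \<Rightarrow> real) \<Rightarrow> ('a \<Rightarrow> real)"
  assumes K: "cell_complex K" and J: "linear_operator_on (cells K k) J"
begin

lemma weight_cell_pos: "x \<in> cells K k \<Longrightarrow> 0 < weight K x"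
  by (rule weight_pos[OF K cell_in_all_cells])

lemma operator_apply:
  assumes f: "f \<in> fun_space (cells K k)"
  shows "J f x = (\<Sum>y\<in>cells K k. operator_matrix K J x y * (weight K y * f y))"
proof -
  have "J f x = (\<Sum>y\<in>cells K k. f y * J (ind y) x)"
    using f finite_cells[OF K] by (intro linear_operator_on_apply[OF J]) auto
  also have "\<dots> = (\<Sum>y\<in>cells K k. operator_matrix K J x y * (weight K y * f y))"
    by (intro sum.cong) (auto simp: operator_matrix_def dest: weight_cell_pos)
  finally show ?thesis .
qed

lemma operator_in_fun_space: "f \<in> fun_space (cells K k) \<Longrightarrow> J f \<in> fun_space (cells K k)"
  using J by (simp add: linear_operator_on_def)

lemma trace_on_operator: "trace_on (cells K k) J = (\<Sum>x\<in>cells K k. weight K x * operator_matrix K J x x)"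
  unfolding trace_on_def by (intro sum.cong) (auto simp: operator_matrix_def dest: weight_cell_pos)

text \<open>The factor \<open>weight K x\<close> in \<open>J (ind x) y\<close> cancels the one by
  which \<open>down_form\<close> differs from the matrix of coboundary after boundary, so the dual
  objective is a pairing of matrices.\<close>

lemma trace_on_coboundary_boundary:
  "trace_on (cells K k) (\<lambda>f. coboundary K (boundary K (J f))) = (\<Sum>x\<in>cells K k. \<Sum>y\<in>cells K k. operator_matrix K J x y * down_form K x y)"
proof -
  have in_K: "x \<in> all_cells K" if "x \<in> cells K k" for x
    using that by (rule cell_in_all_cells)
  have "coboundary K (boundary K (J (ind x))) x = (\<Sum>y\<in>cells K k. operator_matrix K J y x * down_form K y x)" if x: "x \<in> cells K k" for x
  proof -
    let ?g = "J (ind x)"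
    have g: "?g \<in> fun_space (cells K k)"
      using x by (intro operator_in_fun_space ind_in_fun_space)
    have bdry: "boundary K ?g = (\<lambda>v. \<Sum>y\<in>cells K k. ?g y * boundary K (ind y) v)"
      using g finite_cells[OF K]
      by (intro ext linear_operator_on_apply[OF linear_boundary[OF K]] cells_subset_all_cells) auto
    have "coboundary K (boundary K ?g) x = (\<Sum>v\<in>all_cells K. boundary K ?g v * incidence K v x)"
      using g fun_space_mono[OF cells_subset_all_cells]
      by (intro coboundary_apply[OF K] boundary_in_fun_space[OF K]) auto
    also have "\<dots> = (\<Sum>y\<in>cells K k. ?g y * (\<Sum>v\<in>all_cells K. boundary K (ind y) v * incidence K v x))"
      unfolding bdry sum_distrib_right sum_distrib_left mult.assoc by (rule sum.swap)
    also have "\<dots> = (\<Sum>y\<in>cells K k. ?g y * coboundary K (boundary K (ind y)) x)"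
      by (intro sum.cong refl arg_cong2[of _ _ _ _ "(*)"] coboundary_apply[OF K, symmetric]
          boundary_in_fun_space[OF K] ind_in_fun_space) (auto simp: in_K)
    also have "\<dots> = (\<Sum>y\<in>cells K k. operator_matrix K J y x * down_form K y x)"
      using x in_K by (intro sum.cong)
        (auto simp: coboundary_boundary_ind[OF K] operator_matrix_def down_form_sym[OF K, of x])
    finally show ?thesis .
  qed
  then show ?thesis
    unfolding trace_on_def by (subst sum.swap) (intro sum.cong, auto)
qed

lemma coboundary_operator_boundary:
  assumes z: "z \<in> cells K (Suc k)"
  shows "coboundary K (J (boundary K (ind z))) z
    = weight K z * (\<Sum>x\<in>cells K k. \<Sum>y\<in>cells K k. operator_matrix K J x y * (incidence K x z * incidence K y z))"
proof -
  have zK: "z \<in> all_cells K"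
    using z by (rule cell_in_all_cells)
  \<comment> \<open>\<open>J\<close> is constrained only on functions supported on the
    \<open>k\<close>-cells, so the support of the boundary has to be located before \<open>J\<close>
    can be expanded.\<close>
  have bdry: "boundary K (ind z) \<in> fun_space (cells K k)"
    unfolding fun_space_def
  proof (intro CollectI allI impI)
    fix x assume x: "x \<notin> cells K k"
    show "boundary K (ind z) x = 0"
    proof (cases "x \<in> all_cells K")
      case True
      then obtain i where "x \<in> cells K i"
        by (rule all_cellsE)
      then have "incidence K x z = 0"
        using incidence_nonzero_dim[OF K _ z, of x i] x by auto
      then show ?thesis
        by (simp add: boundary_ind[OF K True zK])
    next
      case False
      then show ?thesis
        using boundary_in_fun_space[OF K ind_in_fun_space[OF zK]] by (simp add: fun_space_def)
    qed
  qed
  have J_bdry: "J (boundary K (ind z)) x = weight K z * (\<Sum>y\<in>cells K k. operator_matrix K J x y * incidence K y z)" for x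
    unfolding operator_apply[OF bdry] sum_distrib_left
    by (intro sum.cong) (auto simp: boundary_ind[OF K _ zK] cell_in_all_cells dest: weight_cell_pos)
  have "coboundary K (J (boundary K (ind z))) z = (\<Sum>x\<in>cells K k. J (boundary K (ind z)) x * incidence K x z)"
    by (intro coboundary_apply[OF K] cells_subset_all_cells operator_in_fun_space bdry)
  then show ?thesis
    by (simp add: J_bdry sum_distrib_left sum_distrib_right mult_ac)
qed

lemma inner_product_ind_times:
  "x \<in> cells K k \<Longrightarrow> inner_product K (ind x) (\<lambda>y. \<omega> y * f y) = weight K x * \<omega> x * f x"
  by (simp add: inner_product_ind[OF K cell_in_all_cells])

lemma norm1_fun_space:
  assumes f: "f \<in> fun_space (cells K k)"
  shows "norm1 K \<omega> f = (\<Sum>x\<in>cells K k. weight K x * \<omega> x * \<bar>f x\<bar>)"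
proof -
  have "\<forall>x\<in>all_cells K - cells K k. weight K x * \<omega> x * \<bar>f x\<bar> = 0"
    using f by (simp add: fun_space_def)
  then show ?thesis
    unfolding norm1_def
    by (intro sum.mono_neutral_right finite_all_cells[OF K] cells_subset_all_cells)
qed

text \<open>In terms of \<open>g = weight K * \<omega> * f\<close>, the condition on
  \<open>f\<close> says that \<open>g x\<close> dominates the sum of the other
  \<open>\<bar>g u\<bar>\<close>. If there is another cell, this cone is spanned by the unit vector
  at \<open>x\<close> plus or minus a unit vector elsewhere; positivity on these two-point functions
  is the entry bound.\<close>

lemma operator_positivity_iff:
  assumes \<omega>: "\<And>x. x \<in> cells K k \<Longrightarrow> 0 < \<omega> x"
  shows "(\<forall>x\<in>cells K k. \<forall>f\<in>fun_space (cells K k). 2 * inner_product K (ind x) (\<lambda>y. \<omega> y * f y) \<ge> norm1 K \<omega> f \<longrightarrow> J f x \<ge> 0)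
    \<longleftrightarrow> (\<forall>x\<in>cells K k. \<forall>y\<in>cells K k. \<bar>operator_matrix K J x y\<bar> * \<omega> x \<le> operator_matrix K J x x * \<omega> y)"
    (is "?pos \<longleftrightarrow> ?dom")
proof
  assume pos: ?pos
  show ?dom
  proof (intro ballI)
    fix x y assume x: "x \<in> cells K k" and y: "y \<in> cells K k"
    \<comment> \<open>This scaling makes \<open>a u * ind u\<close> have norm 1.\<close>
    define a where "a u = 1 / (weight K u * \<omega> u)" for u
    have a: "0 < a u" "weight K u * \<omega> u * a u = 1" if "u \<in> cells K k" for u
      using \<omega>[OF that] weight_cell_pos[OF that] by (simp_all add: a_def)
    have Pa: "operator_matrix K J u v * (weight K v * a v) = operator_matrix K J u v / \<omega> v" if "v \<in> cells K k" for u v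
      using \<omega>[OF that] weight_cell_pos[OF that] by (simp add: a_def)
    \<comment> \<open>The test function has norm \<open>1 + \<bar>s\<bar>\<close>, while twice its
      pairing with \<open>x\<close> is 2. The extreme values 1 and -1 of \<open>s\<close> give the
      two halves of the bound.\<close>
    have test: "0 \<le> operator_matrix K J x x / \<omega> x + s * (operator_matrix K J x y / \<omega> y)" if s: "\<bar>s\<bar> \<le> 1" and xy: "x \<noteq> y" for s
    proof -
      define f where "f u = a x * ind x u + s * a y * ind y u" for u
      have f_x: "f x = a x" and f_y: "f y = s * a y" and f_0: "\<And>u. u \<notin> {x, y} \<Longrightarrow> f u = 0"
        using xy by (auto simp: f_def)
      have f: "f \<in> fun_space (cells K k)"
        unfolding fun_space_def using x y by (auto intro!: f_0)
      have sum_xy: "(\<Sum>u\<in>cells K k. g u * h (f u)) = g x * h (a x) + g y * h (s * a y)"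
        if "h 0 = 0" for g h :: "_ \<Rightarrow> real"
      proof -
        have "(\<Sum>u\<in>cells K k. g u * h (f u)) = (\<Sum>u\<in>{x, y}. g u * h (f u))"
          using x y finite_cells[OF K] that by (intro sum.mono_neutral_right) (auto simp: f_0)
        then show ?thesis
          using xy by (simp add: f_x f_y)
      qed
      have "norm1 K \<omega> f = 1 + \<bar>s\<bar>"
        using a[OF x] a[OF y] sum_xy[of abs] unfolding norm1_fun_space[OF f]
        by (simp add: abs_mult mult.left_commute)
      then have "norm1 K \<omega> f \<le> 2 * inner_product K (ind x) (\<lambda>y. \<omega> y * f y)"
        using s a[OF x] by (simp add: inner_product_ind_times[OF x] f_x)
      then have "0 \<le> J f x"
        using pos x f by blast
      also have "J f x = operator_matrix K J x x * (weight K x * a x) + s * (operator_matrix K J x y * (weight K y * a y))"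
        using sum_xy[of "\<lambda>t. t" "\<lambda>u. operator_matrix K J x u * weight K u"] unfolding operator_apply[OF f]
        by (simp add: mult_ac)
      finally show ?thesis
        by (simp add: Pa x y)
    qed
    have diag: "0 \<le> operator_matrix K J x x"
    proof -
      have f: "ind x \<in> fun_space (cells K k)"
        using x by (rule ind_in_fun_space)
      have "norm1 K \<omega> (ind x) = (\<Sum>u\<in>cells K k. if u = x then weight K x * \<omega> x else 0)"
        unfolding norm1_fun_space[OF f] by (intro sum.cong) (auto simp: indicator_def)
      also have "\<dots> \<le> 2 * inner_product K (ind x) (\<lambda>y. \<omega> y * ind x y)"
        using x finite_cells[OF K] weight_cell_pos[OF x] \<omega>[OF x] by (simp add: inner_product_ind_times)
      finally have "0 \<le> J (ind x) x"
        using pos x f by blast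
      then show ?thesis
        using weight_cell_pos[OF x] by (simp add: operator_matrix_def)
    qed
    show "\<bar>operator_matrix K J x y\<bar> * \<omega> x \<le> operator_matrix K J x x * \<omega> y"
    proof (cases "x = y")
      case True
      with diag show ?thesis by simp
    next
      case False
      have "\<bar>operator_matrix K J x y\<bar> / \<omega> y \<le> operator_matrix K J x x / \<omega> x"
        using test[of 1] test[of "-1"] False by (cases "0 \<le> operator_matrix K J x y") auto
      then show ?thesis
        using \<omega>[OF x] \<omega>[OF y] by (simp add: field_simps)
    qed
  qed
next
  assume dom: ?dom
  show ?pos
  proof (intro ballI impI)
    fix x f assume x: "x \<in> cells K k" and f: "f \<in> fun_space (cells K k)"
      and le: "norm1 K \<omega> f \<le> 2 * inner_product K (ind x) (\<lambda>y. \<omega> y * f y)"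
    define g where "g u = weight K u * \<omega> u * f u" for u
    have abs_g: "weight K u * \<omega> u * \<bar>f u\<bar> = \<bar>g u\<bar>" if "u \<in> cells K k" for u
      using \<omega>[OF that] weight_cell_pos[OF that] by (simp add: g_def abs_mult)
    have "\<bar>operator_matrix K J x x\<bar> * \<omega> x \<le> operator_matrix K J x x * \<omega> x"
      using dom x by blast
    then have diag: "0 \<le> operator_matrix K J x x"
      using \<omega>[OF x] by simp
    have "(\<Sum>u\<in>cells K k. \<bar>g u\<bar>) \<le> 2 * g x"
      using le abs_g by (simp add: norm1_fun_space[OF f] inner_product_ind_times[OF x] g_def[symmetric])
    \<comment> \<open>Splitting off the term at \<open>x\<close> leaves at most
      \<open>2 * g x - \<bar>g x\<bar>\<close>.\<close>
    then have g: "(\<Sum>u\<in>cells K k - {x}. \<bar>g u\<bar>) \<le> g x"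
      using x finite_cells[OF K] by (simp add: sum.remove)
    have "0 \<le> operator_matrix K J x x / \<omega> x * (g x - (\<Sum>u\<in>cells K k - {x}. \<bar>g u\<bar>))"
      using diag \<omega>[OF x] g by simp
    also have "\<dots> = operator_matrix K J x x / \<omega> x * g x + (\<Sum>u\<in>cells K k - {x}. - (operator_matrix K J x x / \<omega> x * \<bar>g u\<bar>))"
      by (simp add: right_diff_distrib sum_distrib_left sum_negf)
    also have "\<dots> \<le> operator_matrix K J x x / \<omega> x * g x + (\<Sum>u\<in>cells K k - {x}. operator_matrix K J x u / \<omega> u * g u)"
    proof (intro add_left_mono sum_mono)
      fix u assume u: "u \<in> cells K k - {x}"
      have "\<bar>operator_matrix K J x u\<bar> / \<omega> u \<le> operator_matrix K J x x / \<omega> x"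
        using dom x u \<omega>[OF x] \<omega>[of u] by (simp add: field_simps)
      then have "\<bar>operator_matrix K J x u\<bar> / \<omega> u * \<bar>g u\<bar> \<le> operator_matrix K J x x / \<omega> x * \<bar>g u\<bar>"
        by (rule mult_right_mono) simp
      then have "\<bar>operator_matrix K J x u / \<omega> u * g u\<bar> \<le> operator_matrix K J x x / \<omega> x * \<bar>g u\<bar>"
        using u \<omega>[of u] by (simp add: abs_mult)
      then show "- (operator_matrix K J x x / \<omega> x * \<bar>g u\<bar>) \<le> operator_matrix K J x u / \<omega> u * g u"
        by linarith
    qed
    also have "\<dots> = (\<Sum>u\<in>cells K k. operator_matrix K J x u / \<omega> u * g u)"
      using x finite_cells[OF K] by (simp add: sum.remove[of "cells K k" x])
    also have "\<dots> = J f x"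
      unfolding operator_apply[OF f] by (intro sum.cong) (auto simp: g_def dest: \<omega>)
    finally show "0 \<le> J f x" .
  qed
qed

text \<open>The conditions correspond clause by clause; in (b) the two sides differ by the positive
  factor \<open>weight K z\<close>.\<close>

lemma dual_feasible_iff:
  assumes \<omega>: "\<And>x. x \<in> cells K k \<Longrightarrow> 0 < \<omega> x"
  shows "dual_feasible K k \<omega> J
    \<longleftrightarrow> dual_matrix (cells K k) (cells K (Suc k)) (weight K) \<omega> (incidence K) (operator_matrix K J)"
proof -
  have "coboundary K (J (boundary K (ind z))) z \<le> 0
      \<longleftrightarrow> (\<Sum>x\<in>cells K k. \<Sum>y\<in>cells K k. operator_matrix K J x y * (incidence K x z * incidence K y z)) \<le> 0"
    if z: "z \<in> cells K (Suc k)" for z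
    using weight_pos[OF K cell_in_all_cells[OF z]]
    by (simp add: coboundary_operator_boundary[OF z] mult_le_0_iff)
  then show ?thesis
    unfolding dual_feasible_def dual_matrix_def
    by (simp add: J operator_positivity_iff[OF \<omega>] trace_on_operator)
qed

end

text \<open>Recovers an operator from its kernel; the value 0 off the \<open>k\<close>-cells keeps
  the image in the function space.\<close>

definition matrix_operator :: "'a complex_data \<Rightarrow> nat \<Rightarrow> ('a \<Rightarrow> 'a \<Rightarrow> real) \<Rightarrow> ('a \<Rightarrow> real) \<Rightarrow> ('a \<Rightarrow> real)" where
  "matrix_operator K k P f x = (if x \<in> cells K k then \<Sum>y\<in>cells K k. P x y * (weight K y * f y) else 0)"

lemma linear_matrix_operator: "linear_operator_on (cells K k) (matrix_operator K k P)"
  unfolding linear_operator_on_def fun_space_def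
  by (auto simp: matrix_operator_def fun_eq_iff algebra_simps sum.distrib sum_distrib_left)

lemma operator_matrix_of_matrix_operator:
  assumes K: "cell_complex K" and x: "x \<in> cells K k" and y: "y \<in> cells K k"
  shows "operator_matrix K (matrix_operator K k P) x y = P x y"
proof -
  have "(\<Sum>u\<in>cells K k. P x u * (weight K u * ind y u)) = (\<Sum>u\<in>cells K k. if u = y then P x y * weight K y else 0)"
    by (intro sum.cong) (auto simp: indicator_def)
  then show ?thesis
    using x y finite_cells[OF K] weight_pos[OF K cell_in_all_cells[OF y]]
    by (simp add: operator_matrix_def matrix_operator_def)
qed

lemma dual_matrix_cong:
  "(\<And>x y. x \<in> X \<Longrightarrow> y \<in> X \<Longrightarrow> P x y = P' x y) \<Longrightarrow> dual_matrix X N m w E P \<longleftrightarrow> dual_matrix X N m w E P'"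
  unfolding dual_matrix_def by (simp cong: sum.cong)

section \<open>Weak and strong duality for the Forman curvature\<close>

text \<open>Weak duality with the smallest curvature of \<open>L\<close> as the common lower bound
  and with the coefficients of \<open>L\<close> as the primal vector.\<close>

lemma min_forman_le_trace:
  assumes LK: "subcomplex_from k L K"
    and \<omega>: "\<And>x. x \<in> all_cells K \<Longrightarrow> 0 < \<omega> x" and J: "dual_feasible K k \<omega> J"
  shows "Min (forman L \<omega> ` cells K k) \<le> trace_on (cells K k) (\<lambda>f. coboundary K (boundary K (J f)))"
proof -
  note K = subcomplex_complexes(1)[OF LK] and L = subcomplex_complexes(2)[OF LK]
  have \<omega>': "0 < \<omega> x" "0 < weight K x" if "x \<in> cells K k" for x
    using that \<omega> weight_pos[OF K] by (auto intro: cell_in_all_cells)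
  have lin: "linear_operator_on (cells K k) J"
    using J by (simp add: dual_feasible_def)
  have P: "dual_matrix (cells K k) (cells K (Suc k)) (weight K) \<omega> (incidence K) (operator_matrix K J)"
    using J \<omega>'(1) by (subst (asm) dual_feasible_iff[OF K lin])
  have "Min (forman L \<omega> ` cells K k) \<le> (\<Sum>x\<in>cells K k. \<Sum>y\<in>cells K k. operator_matrix K J x y * down_form K x y)"
  proof (rule dual_matrix_weak_duality[OF finite_cells[OF K] \<omega>'(1) P subcomplex_coeff_nonneg[OF L] \<omega>'(2)])
    fix x assume x: "x \<in> cells K k"
    have "Min (forman L \<omega> ` cells K k) * (\<omega> x * weight K x) \<le> forman L \<omega> x * (\<omega> x * weight K x)"
      using x finite_cells[OF K] \<omega>'[OF x] by (intro mult_right_mono) auto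
    also have "\<dots> = gershgorin (cells K k) \<omega> (curvature_form K k (subcomplex_coeff k L)) x"
      using forman_subcomplex[OF LK x] \<omega>'[OF x] by simp
    finally show "Min (forman L \<omega> ` cells K k) * (\<omega> x * weight K x)
        \<le> gershgorin (cells K k) \<omega> (\<lambda>x y. down_form K x y +
            (\<Sum>z\<in>cells K (Suc k). subcomplex_coeff k L z * (incidence K x z * incidence K y z))) x"
      by (simp add: curvature_form_def[abs_def])
  qed
  then show ?thesis
    by (simp add: trace_on_coboundary_boundary[OF K lin])
qed

text \<open>Both optimizers of the linear program are realized geometrically: \<open>c\<close> by a
  reweighted skeleton, \<open>P\<close> by the operator with that kernel.\<close>

lemma exists_optimal_pair:
  assumes K: "cell_complex K" and ne: "cells K k \<noteq> {}"
    and \<omega>: "\<And>x. x \<in> all_cells K \<Longrightarrow> 0 < \<omega> x"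
  obtains L J where "subcomplex_from k L K" "dual_feasible K k \<omega> J"
    "trace_on (cells K k) (\<lambda>f. coboundary K (boundary K (J f))) \<le> Min (forman L \<omega> ` cells K k)"
proof -
  have \<omega>': "0 < \<omega> x" "0 < weight K x" if "x \<in> cells K k" for x
    using that \<omega> weight_pos[OF K] by (auto intro: cell_in_all_cells)
  obtain f where f: "\<exists>x\<in>cells K k. f x \<noteq> 0"
    and df: "\<forall>z\<in>cells K (Suc k). (\<Sum>x\<in>cells K k. incidence K x z * f x) = 0"
    using exists_cocycle[OF K ne] by blast
  have "\<exists>c P. (\<forall>z\<in>cells K (Suc k). 0 \<le> c z) \<and>
    dual_matrix (cells K k) (cells K (Suc k)) (weight K) \<omega> (incidence K) P \<and>
    (\<forall>x\<in>cells K k. (\<Sum>x\<in>cells K k. \<Sum>y\<in>cells K k. P x y * down_form K x y) * (\<omega> x * weight K x)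
       \<le> gershgorin (cells K k) \<omega> (\<lambda>x y. down_form K x y +
            (\<Sum>z\<in>cells K (Suc k). c z * (incidence K x z * incidence K y z))) x)"
    by (rule dual_matrix_strong_duality[where f = f]) (use finite_cells[OF K] \<omega>' f df in auto)
  then obtain c P where c: "\<forall>z\<in>cells K (Suc k). 0 \<le> c z"
    and P: "dual_matrix (cells K k) (cells K (Suc k)) (weight K) \<omega> (incidence K) P"
    and le: "\<forall>x\<in>cells K k. (\<Sum>x\<in>cells K k. \<Sum>y\<in>cells K k. P x y * down_form K x y) * (\<omega> x * weight K x)
       \<le> gershgorin (cells K k) \<omega> (\<lambda>x y. down_form K x y +
            (\<Sum>z\<in>cells K (Suc k). c z * (incidence K x z * incidence K y z))) x"
    by blast
  define L where "L = reweighted_skeleton k c K"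
  define J where "J = matrix_operator K k P"
  have LK: "subcomplex_from k L K"
    unfolding L_def using K by (rule reweighted_skeleton_subcomplex)
  have lin: "linear_operator_on (cells K k) J"
    unfolding J_def by (rule linear_matrix_operator)
  have PJ: "operator_matrix K J x y = P x y" if "x \<in> cells K k" "y \<in> cells K k" for x y
    unfolding J_def using K that by (rule operator_matrix_of_matrix_operator)
  have "dual_matrix (cells K k) (cells K (Suc k)) (weight K) \<omega> (incidence K) (operator_matrix K J)"
    using P dual_matrix_cong[of "cells K k" "operator_matrix K J" P] PJ by metis
  then have "dual_feasible K k \<omega> J"
    using \<omega>'(1) by (subst dual_feasible_iff[OF K lin])
  with LK show ?thesis
  proof (rule that)
    \<comment> \<open>The skeleton returns exactly the coefficients \<open>c\<close>: removed cells
      have \<open>c z = 0\<close>, which is also their coefficient.\<close>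
    have "curvature_form K k (subcomplex_coeff k L) = (\<lambda>x y. down_form K x y +
            (\<Sum>z\<in>cells K (Suc k). c z * (incidence K x z * incidence K y z)))"
      unfolding curvature_form_def[abs_def] L_def using c
      by (simp add: subcomplex_coeff_reweighted_skeleton)
    then have "trace_on (cells K k) (\<lambda>f. coboundary K (boundary K (J f))) * (\<omega> x * weight K x)
        \<le> forman L \<omega> x * (\<omega> x * weight K x)" if x: "x \<in> cells K k" for x
      using le x forman_subcomplex[OF LK x, of \<omega>] \<omega>'[OF x]
      by (simp add: trace_on_coboundary_boundary[OF K lin] PJ)
    then have "trace_on (cells K k) (\<lambda>f. coboundary K (boundary K (J f))) \<le> forman L \<omega> x"
      if x: "x \<in> cells K k" for x
      using x \<omega>'[OF x] by (meson mult_le_cancel_right_pos mult_pos_pos)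
    then show "trace_on (cells K k) (\<lambda>f. coboundary K (boundary K (J f))) \<le> Min (forman L \<omega> ` cells K k)"
      using ne finite_cells[OF K] by simp
  qed
qed

theorem theorem7p4:
  fixes K :: "'a complex_data" and k :: nat and \<omega> :: "'a \<Rightarrow> real"
  assumes "cell_complex K"
    and "cells K k \<noteq> {}"
    and "\<And>x. x \<in> all_cells K \<Longrightarrow> \<omega> x > 0"
    and "nondegenerate K \<omega>"
  shows "\<exists>K' J.
    is_arg_max (\<lambda>L. Min (forman L \<omega> ` cells K k)) (\<lambda>L. subcomplex_from k L K) K' \<and>
    is_arg_min (\<lambda>I. trace_on (cells K k) (\<lambda>f. coboundary K (boundary K (I f))))
      (dual_feasible K k \<omega>) J \<and>
    Min (forman K' \<omega> ` cells K k) =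
      trace_on (cells K k) (\<lambda>f. coboundary K (boundary K (J f)))"
proof -
  obtain L J where L: "subcomplex_from k L K" and J: "dual_feasible K k \<omega> J"
    and le: "trace_on (cells K k) (\<lambda>f. coboundary K (boundary K (J f))) \<le> Min (forman L \<omega> ` cells K k)"
    by (rule exists_optimal_pair[where \<omega> = \<omega>, OF assms(1,2)]) (rule assms(3))
  have weak: "Min (forman L' \<omega> ` cells K k) \<le> trace_on (cells K k) (\<lambda>f. coboundary K (boundary K (J' f)))"
    if "subcomplex_from k L' K" "dual_feasible K k \<omega> J'" for L' J'
    by (rule min_forman_le_trace[where \<omega> = \<omega>, OF that(1) _ that(2)]) (rule assms(3))
  \<comment> \<open>Equality for this one pair certifies both optima: weak duality against the fixed
    \<open>J\<close> bounds every subcomplex, and against the fixed \<open>L\<close> every feasible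
    operator.\<close>
  have eq: "Min (forman L \<omega> ` cells K k) = trace_on (cells K k) (\<lambda>f. coboundary K (boundary K (J f)))"
    using le weak[OF L J] by (rule antisym[rotated])
  have "is_arg_max (\<lambda>L. Min (forman L \<omega> ` cells K k)) (\<lambda>L. subcomplex_from k L K) L"
    unfolding is_arg_max_def using L weak[OF _ J] eq by (simp add: not_less)
  moreover have "is_arg_min (\<lambda>I. trace_on (cells K k) (\<lambda>f. coboundary K (boundary K (I f))))
      (dual_feasible K k \<omega>) J"
    unfolding is_arg_min_def using J weak[OF L] eq by (simp add: not_less)
  ultimately show ?thesis
    using eq by blast
qed

end
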